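(* Let $1<p<\infty$, $0<q<p-1$, $0<\alpha<n/p$, and let $\sigma$ be a nonnegative locally finite Borel measure on $\mathbb{R}^n$. Suppose that $\sigma(E)\le C\,\mathrm{cap}_{\alpha,p}(E)$ for all compact $E\subset\mathbb{R}^n$, and $$\int_1^{\infty}\Big(\frac{\sigma(B(0,t))}{t^{n-\alpha p}}\Big)^{\frac1{p-1}}\frac{dt}{t}<\infty.$$ Then there exists a solution $u\in L^q_{\rm loc}(\mathbb{R}^n,d\sigma)$, $u\ge0$, of $$u=\mathbf{W}_{\alpha,p}(u^q\,d\sigma)\quad\text{in }\mathbb{R}^n$$ such that $$c^{-1}\big(\mathbf{W}_{\alpha,p}\sigma\big)^{\frac{p-1}{p-1-q}}\le u\le c\Big(\mathbf{W}_{\alpha,p}\sigma+\big(\mathbf{W}_{\alpha,p}\sigma\big)^{\frac{p-1}{p-1-q}}\Big),$$ where $c=c(n,p,q,\alpha,C)>0$. Moreover, $u\in L^s_{\rm loc}(\mathbb{R}^n,d\sigma)$ for every $s>0$.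
   Context: $\mathbf{W}_{\alpha,p}\mu(x)=\int_0^\infty\big(\mu(B(x,t))/t^{n-\alpha p}\big)^{\frac1{p-1}}\frac{dt}{t}$ is the Wolff potential; $u^q d\sigma$ is the measure with density $u^q$ w.r.t. $\sigma$. $\mathbf{I}_\alpha f(x)=\int_0^\infty\frac{\int_{B(x,r)}f\,dy}{r^{n-\alpha}}\frac{dr}{r}$ and $\mathrm{cap}_{\alpha,p}(E)=\inf\{\|f\|_{L^p}^p: f\ge0,\ f\in L^p(\mathbb{R}^n),\ \mathbf{I}_\alpha f\ge1\text{ on }E\}$. *)

theory Defs
  imports "HOL-Analysis.Analysis"
begin

text \<open>Real power of an extended nonnegative real, intended for positive exponents:
  infinity stays infinity, otherwise the usual real power.\<close>
definition epowr :: "ennreal \<Rightarrow> real \<Rightarrow> ennreal" where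
  "epowr x a = (if x = \<infinity> then \<infinity> else ennreal (enn2real x powr a))"

definition wolff :: "real \<Rightarrow> real \<Rightarrow> 'a::euclidean_space measure \<Rightarrow> 'a \<Rightarrow> ennreal" where
  "wolff \<alpha> p \<mu> x =
     (\<integral>\<^sup>+ t\<in>{0<..}. epowr (emeasure \<mu> (ball x t) / ennreal (t powr (real DIM('a) - \<alpha> * p)))
                            (1 / (p - 1)) * ennreal (1 / t) \<partial>lborel)"

definition riesz_pot :: "real \<Rightarrow> ('a::euclidean_space \<Rightarrow> real) \<Rightarrow> 'a \<Rightarrow> ennreal" where
  "riesz_pot \<alpha> f x =
     (\<integral>\<^sup>+ r\<in>{0<..}. (\<integral>\<^sup>+ y\<in>ball x r. ennreal (f y) \<partial>lebesgue)
                        / ennreal (r powr (real DIM('a) - \<alpha>)) * ennreal (1 / r) \<partial>lborel)"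

definition cap :: "real \<Rightarrow> real \<Rightarrow> 'a::euclidean_space set \<Rightarrow> ennreal" where
  "cap \<alpha> p E = (INF f \<in> {f :: 'a \<Rightarrow> real. f \<in> borel_measurable lebesgue \<and> (\<forall>y. 0 \<le> f y)
                      \<and> (\<integral>\<^sup>+ y. ennreal (f y powr p) \<partial>lebesgue) < \<infinity>
                      \<and> (\<forall>x\<in>E. 1 \<le> riesz_pot \<alpha> f x)}.
                 \<integral>\<^sup>+ y. ennreal (f y powr p) \<partial>lebesgue)"

definition Lloc :: "real \<Rightarrow> 'a::euclidean_space measure \<Rightarrow> ('a \<Rightarrow> ennreal) \<Rightarrow> bool" where
  "Lloc s \<sigma> u \<longleftrightarrow> u \<in> borel_measurable \<sigma> \<and>
     (\<forall>K. compact K \<longrightarrow> (\<integral>\<^sup>+ x\<in>K. epowr (u x) s \<partial>\<sigma>) < \<infinity>)"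

end

theory Submission
  imports Defs
begin

text \<open>
  Everything rests on the energy estimate \<open>\<integral> (W \<mu>)\<^sup>s d\<mu> \<le> c \<mu>(UNIV)\<close> for all \<open>s > 0\<close> and all finite
  measures \<open>\<mu>\<close> dominated by \<open>C cap\<close>, a class that is stable under restriction. If it holds for
  \<open>s\<close>, put \<open>\<rho> = W \<mu>\<close>, \<open>\<nu> = \<rho>\<^sup>s \<mu>\<close> and \<open>a = 1 / (p - 1)\<close>. Applied on balls, it gives the pointwise
  bound \<open>W \<nu> \<le> c (\<rho> + \<rho>\<^sup>s\<^sup>a\<^sup>+\<^sup>1)\<close>, while \<open>W \<nu> \<ge> c \<rho>\<^sup>s\<^sup>a\<^sup>+\<^sup>1\<close> always holds. Since \<open>cap {W \<nu> \<ge> l}\<close> is at most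
  \<open>c l\<^sup>-\<^sup>p \<integral> W \<nu> d\<nu>\<close>, the distribution function of \<open>\<rho>\<close> decays with the power \<open>m + p - 1\<close> for
  \<open>m = s + sa + 1\<close>, with constant \<open>c (\<mu>(UNIV) + \<integral> \<rho>\<^sup>m d\<mu>)\<close>. Integrating over levels beyond a
  large one absorbs \<open>\<integral> \<rho>\<^sup>m d\<mu>\<close> and yields the estimate for \<open>m > s + 1\<close>; the case \<open>s = 1\<close> is the same
  argument with \<open>\<nu> = \<mu>\<close>. Absorption needs \<open>\<integral> \<rho>\<^sup>m d\<mu>\<close> to be finite, so the potentials are truncated to
  radii larger than \<open>d > 0\<close>, with constants independent of \<open>d\<close>.

  With \<open>g = (p - 1) / (p - 1 - q)\<close>, the two pointwise bounds make small multiples of \<open>(W \<sigma>)\<^sup>g\<close>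
  subsolutions and large multiples of \<open>W \<sigma> + (W \<sigma>)\<^sup>g\<close> supersolutions, and monotone iteration
  gives a solution in between.
\<close>

section \<open>Powers of extended nonnegative reals\<close>

lemma epowr_ennreal: "0 \<le> x \<Longrightarrow> epowr (ennreal x) a = ennreal (x powr a)"
  by (simp add: epowr_def)

lemma epowr_top [simp]: "epowr top a = top"
  by (simp add: epowr_def)

lemma epowr_0 [simp]: "epowr 0 a = 0"
  by (simp add: epowr_def)

lemma epowr_1 [simp]: "epowr 1 a = 1"
  by (simp add: epowr_def)

lemma epowr_one_exp [simp]: "epowr x 1 = x"
  by (cases x rule: ennreal_cases) (simp_all add: epowr_ennreal)

lemma epowr_less_top: "x < top \<Longrightarrow> epowr x a < top"
  by (simp add: epowr_def)

lemma epowr_pos: "0 < x \<Longrightarrow> 0 < epowr x a"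
  by (cases x rule: ennreal_cases) (simp_all add: epowr_ennreal)

lemma epowr_mono: "x \<le> y \<Longrightarrow> 0 \<le> a \<Longrightarrow> epowr x a \<le> epowr y a"
  by (cases x rule: ennreal_cases; cases y rule: ennreal_cases)
     (auto simp add: epowr_ennreal top_unique intro!: ennreal_leI powr_mono2)

lemma epowr_mult:
  assumes "0 < a"
  shows "epowr (x * y) a = epowr x a * epowr y a"
proof -
  have top: "epowr (top * z) a = top * epowr z a" for z
    by (cases "z = 0") (simp_all add: ennreal_top_mult epowr_pos zero_less_iff_neq_zero[symmetric] less_imp_neq[THEN not_sym])
  show ?thesis
  proof (cases x rule: ennreal_cases; cases y rule: ennreal_cases)
    fix r s :: real
    assume "0 \<le> r" "x = ennreal r" "0 \<le> s" "y = ennreal s"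
    then show ?thesis
      by (simp add: epowr_ennreal ennreal_mult[symmetric] powr_mult)
  qed (use top[of x] top[of y] in \<open>simp_all add: mult.commute\<close>)
qed

lemma epowr_epowr: "epowr (epowr x a) b = epowr x (a * b)"
  by (cases x rule: ennreal_cases) (simp_all add: epowr_ennreal powr_powr)

lemma epowr_add_exp: "epowr x (a + b) = epowr x a * epowr x b"
  by (cases x rule: ennreal_cases) (simp_all add: epowr_ennreal ennreal_mult[symmetric] powr_add)

text \<open>The sum is at most twice the larger term. This serves exponents below and above one
  alike, at the price of the factor \<open>2 powr a\<close>.\<close>

lemma epowr_plus_le:
  assumes "0 < a"
  shows "epowr (x + y) a \<le> ennreal (2 powr a) * (epowr x a + epowr y a)"
proof -
  have *: "epowr (x + y) a \<le> ennreal (2 powr a) * epowr y a" if "x \<le> y" for x y :: ennreal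
  proof -
    have "epowr (x + y) a \<le> epowr (2 * y) a"
      using that assms by (intro epowr_mono) (auto simp: mult_2 add_mono)
    also have "\<dots> = ennreal (2 powr a) * epowr y a"
      using assms epowr_ennreal[of 2 a] by (simp add: epowr_mult)
    finally show ?thesis .
  qed
  show ?thesis
  proof (cases "x \<le> y")
    case True
    then show ?thesis
      using *[OF True] by (auto elim!: order_trans intro!: mult_left_mono)
  next
    case False
    then have "y \<le> x" by simp
    from *[OF this] show ?thesis
      by (auto simp: add.commute elim!: order_trans intro!: mult_left_mono)
  qed
qed

lemma epowr_measurable [measurable]: "(\<lambda>x. epowr x a) \<in> borel_measurable borel"
  unfolding epowr_def by measurable

lemma epowr_inverse: "0 < a \<Longrightarrow> epowr (epowr x a) (1 / a) = x" "0 < a \<Longrightarrow> epowr (epowr x (1 / a)) a = x"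
  by (simp_all add: epowr_epowr)

text \<open>The power with exponent \<open>1 / a\<close> is a monotone inverse, so an upper bound
  for the powers turns into one for the \<open>f i\<close>.\<close>

lemma epowr_SUP:
  assumes "0 < a"
  shows "epowr (SUP i\<in>I. f i) a = (SUP i\<in>I. epowr (f i) a)"
proof (rule antisym)
  let ?z = "SUP i\<in>I. epowr (f i) a"
  have "f i \<le> epowr ?z (1 / a)" if "i \<in> I" for i
    using epowr_mono[OF SUP_upper[OF that], of "1 / a" "\<lambda>i. epowr (f i) a"] assms
    by (simp add: epowr_inverse)
  then have "(SUP i\<in>I. f i) \<le> epowr ?z (1 / a)"
    by (rule SUP_least)
  then show "epowr (SUP i\<in>I. f i) a \<le> ?z"
    using epowr_mono[of _ _ a] assms by (metis epowr_inverse(2) less_imp_le)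
qed (use assms in \<open>auto intro!: SUP_least epowr_mono SUP_upper\<close>)

text \<open>Below one the left power is at most one; above one powers grow with the exponent. On a
  finite measure this passes from a high exponent to a lower one.\<close>

lemma epowr_le_add:
  assumes "0 \<le> s" "s \<le> m"
  shows "epowr x s \<le> 1 + epowr x m"
proof (cases x rule: ennreal_cases)
  case (real r)
  have "r powr s \<le> 1 + r powr m"
  proof (cases "r \<le> 1")
    case True
    then show ?thesis
      using powr_mono2[of s r 1] real assms by (auto intro: add_increasing2)
  next
    case False
    then show ?thesis
      using powr_mono[of s m r] assms by linarith
  qed
  then show ?thesis
    using real by (simp add: epowr_ennreal ennreal_leI flip: ennreal_1 ennreal_plus)
qed simp

section \<open>Truncated Wolff potentials\<close>

text \<open>The Wolff integral restricted to radii above \<open>d\<close>. The exponents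
  \<open>a = 1 / (p - 1)\<close> and \<open>b = (n - \<alpha> * p) / (p - 1)\<close> give the Wolff
  potential at \<open>d = 0\<close>; they are kept free because the test function for the capacity
  uses \<open>a + 1\<close> and \<open>b + n\<close>.\<close>

definition wolff_tail :: "real \<Rightarrow> real \<Rightarrow> real \<Rightarrow> 'a::euclidean_space measure \<Rightarrow> 'a \<Rightarrow> ennreal" where
  "wolff_tail a b d \<mu> x =
     (\<integral>\<^sup>+ t\<in>{d<..}. epowr (emeasure \<mu> (ball x t)) a * ennreal (t powr (- b - 1)) \<partial>lborel)"

lemma wolff_integrand_eq:
  assumes "1 < p" "0 < t"
  shows "epowr (m / ennreal (t powr e)) (1 / (p - 1)) * ennreal (1 / t) =
    epowr m (1 / (p - 1)) * ennreal (t powr (- (e / (p - 1)) - 1))"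
proof -
  have "m / ennreal (t powr e) = m * ennreal (t powr - e)"
    using assms by (simp add: divide_ennreal_def inverse_ennreal powr_minus)
  then have "epowr (m / ennreal (t powr e)) (1 / (p - 1)) =
      epowr m (1 / (p - 1)) * ennreal (t powr (- e * (1 / (p - 1))))"
    using assms by (simp add: epowr_mult epowr_ennreal powr_powr)
  moreover have "t powr (- e * (1 / (p - 1))) * (1 / t) = t powr (- (e / (p - 1)) - 1)"
    using assms by (simp add: powr_diff)
  ultimately show ?thesis
    using assms by (simp add: mult.assoc ennreal_mult[symmetric])
qed

lemma wolff_eq_wolff_tail:
  fixes \<mu> :: "'a::euclidean_space measure"
  assumes "1 < p"
  shows "wolff \<alpha> p \<mu> x = wolff_tail (1 / (p - 1)) ((real DIM('a) - \<alpha> * p) / (p - 1)) 0 \<mu> x"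
  unfolding wolff_def wolff_tail_def
  by (intro nn_integral_cong) (auto split: split_indicator simp: wolff_integrand_eq[OF assms])

text \<open>An open ball is the increasing union of smaller concentric balls, so its measure is
  lower semicontinuous jointly in centre and radius: the superlevel sets are open. Joint
  measurability is what the later uses of Fubini ask for.\<close>

lemma borel_measurable_emeasure_ball [measurable]:
  fixes \<mu> :: "'a::euclidean_space measure"
  assumes "sets \<mu> = sets borel"
  shows "(\<lambda>(x, t). emeasure \<mu> (ball x t)) \<in> borel_measurable (borel \<Otimes>\<^sub>M borel)"
proof -
  have "open {z :: 'a \<times> real. m < emeasure \<mu> (ball (fst z) (snd z))}" for m
  proof (subst open_dist, safe)
    fix x :: 'a and t :: real
    assume *: "m < emeasure \<mu> (ball (fst (x, t)) (snd (x, t)))"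
    define B where "B k = ball x (t - 1 / real (Suc k))" for k :: nat
    have "(\<Union>k. B k) = ball x t"
    proof (intro equalityI subsetI)
      fix y assume "y \<in> ball x t"
      then have "0 < t - dist x y" by simp
      then obtain k where "1 / real (Suc k) < t - dist x y"
        using nat_approx_posE by blast
      then show "y \<in> (\<Union>k. B k)"
        unfolding B_def by (intro UN_I[of k]) (auto simp del: of_nat_Suc)
    next
      fix y assume "y \<in> (\<Union>k. B k)"
      then obtain k where "dist x y < t - 1 / real (Suc k)" by (auto simp: B_def)
      moreover have "0 < 1 / real (Suc k)" by simp
      ultimately show "y \<in> ball x t" by (simp only: mem_ball)
    qed
    moreover have "incseq B"
      unfolding B_def by (auto intro!: incseq_SucI subset_ball simp: frac_le)
    ultimately have "emeasure \<mu> (ball x t) = (SUP k. emeasure \<mu> (B k))"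
      by (subst SUP_emeasure_incseq) (auto simp: B_def assms)
    with * obtain k where k: "m < emeasure \<mu> (B k)"
      by (auto simp: less_SUP_iff)
    \<comment> \<open>Half of the gap between the radii: moving centre and radius by less than
      \<open>e\<close> each still keeps the smaller ball inside the moved one.\<close>
    define e where "e = 1 / (2 * real (Suc k))"
    have sub: "B k \<subseteq> ball x' t'" if "dist (x', t') (x, t) < e" for x' t'
    proof
      fix y assume "y \<in> B k"
      moreover have "2 * e = 1 / real (Suc k)" by (simp add: e_def field_simps)
      ultimately have "dist x y < t - 2 * e" by (simp only: B_def mem_ball)
      moreover have "dist x' x < e" "dist t' t < e"
        using that dist_fst_le[of "(x', t')" "(x, t)"] dist_snd_le[of "(x', t')" "(x, t)"] by auto
      ultimately show "y \<in> ball x' t'"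
        using dist_triangle[of x' y x] by (auto simp: dist_real_def)
    qed
    have "m < emeasure \<mu> (ball (fst z) (snd z))" if "dist z (x, t) < e" for z
    proof -
      have "B k \<subseteq> ball (fst z) (snd z)"
        using sub[of "fst z" "snd z"] that by simp
      then show ?thesis
        using k emeasure_mono[of "B k" "ball (fst z) (snd z)" \<mu>] assms by (auto elim: less_le_trans)
    qed
    moreover have "0 < e" by (simp add: e_def)
    ultimately show "\<exists>e>0. \<forall>z. dist z (x, t) < e \<longrightarrow> z \<in> {z. m < emeasure \<mu> (ball (fst z) (snd z))}"
      by blast
  qed
  then have "(\<lambda>z. emeasure \<mu> (ball (fst z) (snd z))) \<in> borel_measurable (borel :: ('a \<times> real) measure)"
    by (intro borel_measurableI_greater) (auto intro!: borel_open)
  then show ?thesis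
    by (simp add: borel_prod case_prod_beta')
qed

lemma borel_measurable_emeasure_ball_comp [measurable (raw)]:
  fixes \<mu> :: "'a::euclidean_space measure"
  assumes "sets \<mu> = sets borel" "f \<in> borel_measurable M" "g \<in> borel_measurable M"
  shows "(\<lambda>z. emeasure \<mu> (ball (f z) (g z))) \<in> borel_measurable M"
proof -
  have "(\<lambda>z. (f z, g z)) \<in> M \<rightarrow>\<^sub>M borel \<Otimes>\<^sub>M borel"
    using assms(2,3) by measurable
  from measurable_compose[OF this borel_measurable_emeasure_ball[OF assms(1)]] show ?thesis
    by simp
qed

lemma borel_measurable_wolff_tail [measurable (raw)]:
  assumes [simp]: "sets \<mu> = sets borel"
  shows "wolff_tail a b d \<mu> \<in> borel_measurable borel"
  unfolding wolff_tail_def[abs_def] by measurable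

section \<open>Monotonicity, dilation and translation of truncated potentials\<close>

lemma wolff_tail_antimono: "d \<le> d' \<Longrightarrow> wolff_tail a b d' \<mu> x \<le> wolff_tail a b d \<mu> x"
  unfolding wolff_tail_def by (intro nn_integral_mono) (auto split: split_indicator)

lemma wolff_tail_mono:
  assumes "0 \<le> a" and "\<And>t. d < t \<Longrightarrow> emeasure \<mu> (ball x t) \<le> emeasure \<nu> (ball x t)"
  shows "wolff_tail a b d \<mu> x \<le> wolff_tail a b d \<nu> x"
  unfolding wolff_tail_def
  by (intro nn_integral_mono) (auto split: split_indicator intro!: mult_right_mono epowr_mono assms)

text \<open>Substitution of \<open>2 * t\<close> for the radius; the weight
  \<open>t powr (- b - 1)\<close> together with the Jacobian scales by
  \<open>2 powr b\<close>.\<close>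

lemma wolff_tail_dilate:
  assumes [simp]: "sets \<mu> = sets borel" and "0 \<le> d"
  shows "(\<integral>\<^sup>+ t\<in>{d<..}. epowr (emeasure \<mu> (ball x (2 * t))) a * ennreal (t powr (- b - 1)) \<partial>lborel)
    = ennreal (2 powr b) * wolff_tail a b (2 * d) \<mu> x"
proof -
  let ?h = "\<lambda>t. epowr (emeasure \<mu> (ball x (2 * t))) a"
  have eq: "ennreal (t powr (- b - 1)) = ennreal (2 powr (b + 1)) * ennreal ((2 * t) powr (- b - 1))" if "0 < t" for t :: real
  proof -
    have "2 powr (b + 1) * (2 * t) powr (- b - 1) = (2 powr (b + 1) * 2 powr (- b - 1)) * t powr (- b - 1)"
      using that by (simp add: powr_mult)
    also have "2 powr (b + 1) * (2::real) powr (- b - 1) = 1"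
      by (simp add: powr_add[symmetric])
    finally show ?thesis by (simp add: ennreal_mult[symmetric])
  qed
  have "(\<integral>\<^sup>+ t\<in>{d<..}. ?h t * ennreal (t powr (- b - 1)) \<partial>lborel)
     = (\<integral>\<^sup>+ t. ennreal (2 powr (b + 1)) * (?h t * ennreal ((2 * t) powr (- b - 1)) * indicator {2 * d<..} (2 * t)) \<partial>lborel)"
  proof (rule nn_integral_cong)
    fix t :: real
    show "?h t * ennreal (t powr (- b - 1)) * indicator {d<..} t =
        ennreal (2 powr (b + 1)) * (?h t * ennreal ((2 * t) powr (- b - 1)) * indicator {2 * d<..} (2 * t))"
    proof (cases "d < t")
      case True
      then have "0 < t"
        using \<open>0 \<le> d\<close> by simp
      show ?thesis
        unfolding eq[OF \<open>0 < t\<close>] using True by (simp add: mult_ac)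
    qed simp
  qed
  also have "\<dots> = ennreal (2 powr (b + 1)) * (\<integral>\<^sup>+ t. ?h t * ennreal ((2 * t) powr (- b - 1)) * indicator {2 * d<..} (2 * t) \<partial>lborel)"
    by (rule nn_integral_cmult) measurable
  also have "wolff_tail a b (2 * d) \<mu> x =
     2 * (\<integral>\<^sup>+ t. ?h t * ennreal ((2 * t) powr (- b - 1)) * indicator {2 * d<..} (2 * t) \<partial>lborel)"
    unfolding wolff_tail_def by (subst nn_integral_real_affine[where c = 2 and t = 0]) simp_all
  then have "ennreal (2 powr (b + 1)) * (\<integral>\<^sup>+ t. ?h t * ennreal ((2 * t) powr (- b - 1)) * indicator {2 * d<..} (2 * t) \<partial>lborel)
     = ennreal (2 powr b) * wolff_tail a b (2 * d) \<mu> x"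
    by (simp add: powr_add ennreal_mult mult_ac)
  finally show ?thesis .
qed

text \<open>Radii above \<open>d\<close> exceed the distance of the centres, so
  \<open>ball y t\<close> lies in \<open>ball x (2 * t)\<close>, and dilation costs
  \<open>2 powr b\<close>. This is a Harnack type inequality: at scale \<open>d\<close> the far part
  of the potential is constant up to a factor.\<close>

lemma wolff_tail_shift:
  assumes [simp]: "sets \<mu> = sets borel" and "0 \<le> a" "dist x y \<le> d"
  shows "wolff_tail a b d \<mu> y \<le> ennreal (2 powr b) * wolff_tail a b d \<mu> x"
proof -
  have "0 \<le> d"
    using assms(3) zero_le_dist order_trans by blast
  have "ball y t \<subseteq> ball x (2 * t)" if "d < t" for t
  proof
    fix z assume "z \<in> ball y t"
    then show "z \<in> ball x (2 * t)"
      using dist_triangle[of x z y] that assms(3) by simp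
  qed
  then have "wolff_tail a b d \<mu> y \<le>
      (\<integral>\<^sup>+ t\<in>{d<..}. epowr (emeasure \<mu> (ball x (2 * t))) a * ennreal (t powr (- b - 1)) \<partial>lborel)"
    unfolding wolff_tail_def
    by (intro nn_integral_mono) (auto split: split_indicator intro!: mult_right_mono epowr_mono emeasure_mono \<open>0 \<le> a\<close>)
  also have "\<dots> \<le> ennreal (2 powr b) * wolff_tail a b d \<mu> x"
    using \<open>0 \<le> d\<close> by (subst wolff_tail_dilate) (auto intro!: mult_left_mono wolff_tail_antimono)
  finally show ?thesis .
qed

section \<open>Size and monotone limits of truncated potentials\<close>

lemma nn_integral_powr_tail:
  assumes "0 < b" "0 < d"
  shows "(\<integral>\<^sup>+ t\<in>{d<..}. ennreal (t powr (- b - 1)) \<partial>lborel) = ennreal (d powr (- b) / b)"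
proof -
  have "(\<integral>\<^sup>+ t. ennreal (t powr (- b - 1)) * indicator {d..} t \<partial>lborel) = ennreal (0 - - (d powr (- b) / b))"
  proof (rule nn_integral_FTC_atLeast)
    show "((\<lambda>t. - (t powr (- b) / b)) has_field_derivative t powr (- b - 1)) (at t)" if "d \<le> t" for t
      using that assms by (auto intro!: derivative_eq_intros)
    have "((\<lambda>t. t powr (- b)) \<longlongrightarrow> 0) at_top"
      using assms by (intro tendsto_neg_powr filterlim_ident) auto
    then show "((\<lambda>t. - (t powr (- b) / b)) \<longlongrightarrow> 0) at_top"
      using tendsto_minus[OF tendsto_divide[OF _ tendsto_const[of b]]] assms(1) by fastforce
  qed auto
  moreover have "(\<integral>\<^sup>+ t\<in>{d<..}. ennreal (t powr (- b - 1)) \<partial>lborel) = (\<integral>\<^sup>+ t. ennreal (t powr (- b - 1)) * indicator {d..} t \<partial>lborel)"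
    using AE_lborel_singleton[of d] by (intro nn_integral_cong_AE) (auto split: split_indicator)
  ultimately show ?thesis by simp
qed

text \<open>Each ball has at most the total mass, and the weight is integrable away from zero. This
  uniform bound is what the truncation is for: it makes the powers that are absorbed later
  integrable against a finite measure.\<close>

lemma wolff_tail_le:
  assumes [simp]: "sets \<mu> = sets borel" and "0 \<le> a" "0 < b" "0 < d"
  shows "wolff_tail a b d \<mu> x \<le> epowr (emeasure \<mu> UNIV) a * ennreal (d powr (- b) / b)"
proof -
  have "wolff_tail a b d \<mu> x \<le> (\<integral>\<^sup>+ t. epowr (emeasure \<mu> UNIV) a * (ennreal (t powr (- b - 1)) * indicator {d<..} t) \<partial>lborel)"
    unfolding wolff_tail_def using \<open>0 \<le> a\<close>
    by (intro nn_integral_mono) (auto split: split_indicator intro!: mult_right_mono epowr_mono emeasure_mono)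
  also have "\<dots> = epowr (emeasure \<mu> UNIV) a * ennreal (d powr (- b) / b)"
    by (subst nn_integral_cmult) (auto simp: nn_integral_powr_tail assms)
  finally show ?thesis .
qed

lemma wolff_tail_finite:
  assumes "sets \<mu> = sets borel" "emeasure \<mu> UNIV < top" "0 \<le> a" "0 < b" "0 < d"
  shows "wolff_tail a b d \<mu> x < top"
  using wolff_tail_le[OF assms(1,3-5), of x] epowr_less_top[OF assms(2), of a]
  by (auto elim!: le_less_trans simp: ennreal_mult_less_top)

text \<open>Monotone convergence for the potential, given convergence of the measures on balls; it
  carries the fixed point equation to the limit of the iteration.\<close>

lemma wolff_tail_SUP:
  assumes "0 < a" and [simp]: "\<And>k. sets (\<mu> k) = sets borel"
    and inc: "\<And>t. d < t \<Longrightarrow> incseq (\<lambda>k. emeasure (\<mu> k) (ball x t))"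
    and sup: "\<And>t. d < t \<Longrightarrow> emeasure \<nu> (ball x t) = (SUP k. emeasure (\<mu> k) (ball x t))"
  shows "wolff_tail a b d \<nu> x = (SUP k. wolff_tail a b d (\<mu> k) x)"
proof -
  have "wolff_tail a b d \<nu> x = (\<integral>\<^sup>+ t. (SUP k. epowr (emeasure (\<mu> k) (ball x t)) a * ennreal (t powr (- b - 1)) * indicator {d<..} t) \<partial>lborel)"
    unfolding wolff_tail_def using \<open>0 < a\<close>
    by (intro nn_integral_cong) (auto split: split_indicator simp: sup epowr_SUP SUP_mult_right_ennreal)
  also have "\<dots> = (SUP k. wolff_tail a b d (\<mu> k) x)"
    unfolding wolff_tail_def using \<open>0 < a\<close>
    by (intro nn_integral_monotone_convergence_SUP)
       (auto split: split_indicator simp: incseq_def le_fun_def intro!: mult_right_mono epowr_mono dest: inc[unfolded incseq_def])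
  finally show ?thesis .
qed

text \<open>Monotone convergence over half-lines increasing to \<open>{t<..}\<close>. This is right
  continuity of the tail integral, also when the tail is infinite.\<close>

lemma SUP_nn_integral_greaterThan:
  assumes [measurable]: "g \<in> borel_measurable lborel"
  shows "(\<integral>\<^sup>+ r\<in>{t<..}. g r \<partial>lborel) = (SUP k. \<integral>\<^sup>+ r\<in>{t + 1 / real (Suc k)<..}. g r \<partial>lborel)"
proof -
  have *: "indicator {t<..} r = (SUP k. indicator {t + 1 / real (Suc k)<..} r :: ennreal)" for r
  proof (rule antisym)
    show "indicator {t<..} r \<le> (SUP k. indicator {t + 1 / real (Suc k)<..} r :: ennreal)"
    proof (cases "t < r")
      case True
      then obtain k where k: "1 / real (Suc k) < r - t"
        using nat_approx_posE[of "r - t"] by auto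
      then have "indicator {t<..} r \<le> (indicator {t + 1 / real (Suc k)<..} r :: ennreal)"
        by (auto split: split_indicator simp del: of_nat_Suc)
      also have "\<dots> \<le> (SUP k. indicator {t + 1 / real (Suc k)<..} r)"
        by (rule SUP_upper) simp
      finally show ?thesis .
    qed simp
    show "(SUP k. indicator {t + 1 / real (Suc k)<..} r :: ennreal) \<le> indicator {t<..} r"
    proof (rule SUP_least)
      fix k
      have "t < t + 1 / real (Suc k)" by simp
      then have "{t + 1 / real (Suc k)<..} \<subseteq> {t<..}"
        by (meson greaterThan_iff less_trans subsetI)
      moreover have "(indicator A r :: ennreal) \<le> indicator B r" if "A \<subseteq> B" for A B
        using that by (auto split: split_indicator)
      ultimately show "(indicator {t + 1 / real (Suc k)<..} r :: ennreal) \<le> indicator {t<..} r"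
        by blast
    qed
  qed
  have "(\<integral>\<^sup>+ r\<in>{t<..}. g r \<partial>lborel) = (\<integral>\<^sup>+ r. (SUP k. g r * indicator {t + 1 / real (Suc k)<..} r) \<partial>lborel)"
    by (subst *) (simp add: SUP_mult_left_ennreal)
  also have "\<dots> = (SUP k. \<integral>\<^sup>+ r\<in>{t + 1 / real (Suc k)<..}. g r \<partial>lborel)"
  proof (rule nn_integral_monotone_convergence_SUP)
    show "incseq (\<lambda>k r. g r * indicator {t + 1 / real (Suc k)<..} r)"
    proof (intro incseq_SucI le_funI mult_left_mono)
      fix k r
      have "1 / real (Suc (Suc k)) \<le> 1 / real (Suc k)" by (simp add: frac_le)
      then show "(indicator {t + 1 / real (Suc k)<..} r :: ennreal) \<le> indicator {t + 1 / real (Suc (Suc k))<..} r"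
        by (auto split: split_indicator simp del: of_nat_Suc)
    qed simp
  qed simp
  finally show ?thesis .
qed

lemma wolff_tail_0_eq_SUP:
  assumes [simp]: "sets \<mu> = sets borel"
  shows "wolff_tail a b 0 \<mu> x = (SUP k. wolff_tail a b (1 / real (Suc k)) \<mu> x)"
  unfolding wolff_tail_def by (subst SUP_nn_integral_greaterThan) (simp_all del: of_nat_Suc)

text \<open>With \<open>T t\<close> the tail integral, the left-hand side would be \<open>T d\<^sup>k\<^sup>+\<^sup>1 / (k + 1)\<close> by the
  substitution \<open>T' = - g\<close>. Splitting at the point where \<open>T\<close> drops below half of \<open>T d\<close> avoids
  differentiation and also covers \<open>T d = \<infinity>\<close>.\<close>

lemma nn_integral_tail_power_ge:
  fixes g :: "real \<Rightarrow> ennreal"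
  defines "T \<equiv> \<lambda>t. \<integral>\<^sup>+ r\<in>{t<..}. g r \<partial>lborel"
  assumes [measurable]: "g \<in> borel_measurable lborel" and "0 < k"
  shows "(\<integral>\<^sup>+ t\<in>{d<..}. epowr (T t) k * g t \<partial>lborel) \<ge> ennreal ((1 / 2) powr (k + 1)) * epowr (T d) (k + 1)"
proof -
  have T_anti: "T t' \<le> T t" if "t \<le> t'" for t t'
    unfolding T_def using that by (intro nn_integral_mono) (auto split: split_indicator)
  \<comment> \<open>\<open>m\<close> is a level of the tail and \<open>z\<close> a bound for the
    mass lying before the tail falls below it; there the integrand is at least
    \<open>epowr m k * g t\<close>.\<close>
  have split: "(\<integral>\<^sup>+ t\<in>{d<..}. epowr (T t) k * g t \<partial>lborel) \<ge> epowr m k * z"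
    if le: "z + m \<le> T d" and fin: "m < top" for m z
  proof -
    let ?S = "{t. d < t \<and> T t < m}"
    have lower: "epowr m k * (\<integral>\<^sup>+ t\<in>A. g t \<partial>lborel) \<le> (\<integral>\<^sup>+ t\<in>{d<..}. epowr (T t) k * g t \<partial>lborel)"
      if "A \<subseteq> {d<..} - ?S" and [measurable]: "A \<in> sets borel" for A
    proof -
      have "epowr m k * (\<integral>\<^sup>+ t\<in>A. g t \<partial>lborel) = (\<integral>\<^sup>+ t. epowr m k * (g t * indicator A t) \<partial>lborel)"
        by (rule nn_integral_cmult[symmetric]) simp
      also have "\<dots> \<le> (\<integral>\<^sup>+ t\<in>{d<..}. epowr (T t) k * g t \<partial>lborel)"
        using that(1) \<open>0 < k\<close>
        by (intro nn_integral_mono) (auto split: split_indicator simp: subset_iff not_less intro!: mult_right_mono epowr_mono)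
      finally show ?thesis .
    qed
    have "\<exists>A. A \<subseteq> {d<..} - ?S \<and> A \<in> sets borel \<and> z \<le> (\<integral>\<^sup>+ t\<in>A. g t \<partial>lborel)"
    proof (cases "?S = {}")
      case True
      have "z \<le> T d"
        using le by (rule order_trans[rotated]) simp
      then show ?thesis
        using True unfolding T_def by (intro exI[of _ "{d<..}"]) auto
    next
      case False
      \<comment> \<open>Between \<open>d\<close> and \<open>i\<close> the tail is at least
        \<open>m\<close>, and right continuity gives \<open>T i \<le> m\<close> at \<open>i\<close>
        itself, so the mass before \<open>i\<close> is at least \<open>z\<close>.\<close>
      define i where "i = Inf ?S"
      have bdd: "bdd_below ?S"
        by (auto intro!: bdd_belowI[of _ d] less_imp_le)
      have "d \<le> i"
        unfolding i_def using False by (intro cInf_greatest) auto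
      have "T (i + 1 / real (Suc j)) \<le> m" for j
      proof -
        have "i < i + 1 / real (Suc j)"
          by simp
        then obtain t where "t \<in> ?S" "t < i + 1 / real (Suc j)"
          using cInf_lessD[OF False, of "i + 1 / real (Suc j)"] unfolding i_def by blast
        then show ?thesis
          using T_anti[of t "i + 1 / real (Suc j)"] by auto
      qed
      then have "T i \<le> m"
        unfolding T_def by (subst SUP_nn_integral_greaterThan) (auto intro!: SUP_least)
      have "T d = (\<integral>\<^sup>+ t. g t * indicator {d<..<i} t + g t * indicator {i<..} t \<partial>lborel)"
        unfolding T_def using AE_lborel_singleton[of i] \<open>d \<le> i\<close>
        by (intro nn_integral_cong_AE) (auto split: split_indicator)
      also have "\<dots> = (\<integral>\<^sup>+ t\<in>{d<..<i}. g t \<partial>lborel) + T i"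
        unfolding T_def by (intro nn_integral_add) auto
      also have "\<dots> \<le> (\<integral>\<^sup>+ t\<in>{d<..<i}. g t \<partial>lborel) + m"
        using \<open>T i \<le> m\<close> by (intro add_left_mono)
      finally have "z + m \<le> (\<integral>\<^sup>+ t\<in>{d<..<i}. g t \<partial>lborel) + m"
        using le by (rule order_trans[rotated])
      then have "z \<le> (\<integral>\<^sup>+ t\<in>{d<..<i}. g t \<partial>lborel)"
        using fin by (auto simp: ennreal_add_left_cancel_le add.commute[of _ m])
      moreover have "{d<..<i} \<subseteq> {d<..} - ?S"
        using cInf_lower[OF _ bdd] unfolding i_def by force
      ultimately show ?thesis
        by (intro exI[of _ "{d<..<i}"]) auto
    qed
    then show ?thesis
      using lower by (meson mult_left_mono order_trans zero_le)
  qed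
  show ?thesis
  proof (cases "T d" rule: ennreal_cases)
    case (real r)
    \<comment> \<open>Level and mass are both half of the tail, which gives the factor
      \<open>(1 / 2) powr (k + 1)\<close>.\<close>
    have "ennreal (r / 2) + ennreal (r / 2) \<le> T d"
      using real by (simp flip: ennreal_plus)
    from split[OF this] have "ennreal ((r / 2) powr k * (r / 2)) \<le> (\<integral>\<^sup>+ t\<in>{d<..}. epowr (T t) k * g t \<partial>lborel)"
      using real by (simp add: epowr_ennreal ennreal_mult[symmetric])
    moreover have "(r / 2) powr k * (r / 2) = (1 / 2) powr (k + 1) * r powr (k + 1)"
      using real by (simp add: powr_add powr_divide)
    ultimately show ?thesis
      using real by (simp add: epowr_ennreal ennreal_mult)
  next
    case top
    \<comment> \<open>An infinite tail is cut at level one: the mass before the cut is infinite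
      because the rest is at most one.\<close>
    then show ?thesis
      using split[of top 1] by (simp add: ennreal_mult_top top_unique)
  qed
qed

lemma emeasure_density_ge:
  assumes [measurable_cong]: "sets \<mu> = sets borel" and [measurable]: "f \<in> borel_measurable borel" "A \<in> sets borel"
    and "\<And>y. y \<in> A \<Longrightarrow> m \<le> f y"
  shows "m * emeasure \<mu> A \<le> emeasure (density \<mu> f) A"
proof -
  have "m * emeasure \<mu> A = (\<integral>\<^sup>+ y. m * indicator A y \<partial>\<mu>)"
    by (simp add: nn_integral_cmult_indicator)
  also have "\<dots> \<le> (\<integral>\<^sup>+ y\<in>A. f y \<partial>\<mu>)"
    by (intro nn_integral_mono) (auto split: split_indicator intro: assms)
  also have "\<dots> = emeasure (density \<mu> f) A"
    by (simp add: emeasure_density)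
  finally show ?thesis .
qed

section \<open>Wolff potentials of powers of Wolff potentials\<close>

text \<open>For \<open>y\<close> in \<open>ball x t\<close> the tails at scale \<open>t\<close> are
  comparable at \<open>x\<close> and \<open>y\<close>, so the new measure of \<open>ball x t\<close>
  is at least a constant times \<open>epowr (wolff_tail a b t \<mu> x) s * emeasure \<mu> (ball x
  t)\<close>. The resulting integrand is a power of the tail times its own density, to which
  \<open>nn_integral_tail_power_ge\<close> applies. The constant joins
  \<open>2 powr (- b * s * a)\<close> from the comparison and \<open>2 powr (- s * a - 1)\<close>
  from halving the tail.\<close>

lemma wolff_tail_power_lower:
  fixes \<mu> :: "'a::euclidean_space measure"
  assumes [simp, measurable_cong]: "sets \<mu> = sets borel" and "0 < a" "0 < s" "0 \<le> d"
  shows "ennreal (2 powr (- b * s * a - s * a - 1)) * epowr (wolff_tail a b d \<mu> x) (s * a + 1)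
    \<le> wolff_tail a b d (density \<mu> (\<lambda>y. epowr (wolff_tail a b d \<mu> y) s)) x"
proof -
  define K where "K = ennreal (2 powr (- b * s * a))"
  define g where "g t = epowr (emeasure \<mu> (ball x t)) a * ennreal (t powr (- b - 1))" for t
  have [measurable]: "g \<in> borel_measurable borel"
    unfolding g_def by measurable
  let ?\<nu> = "density \<mu> (\<lambda>y. epowr (wolff_tail a b d \<mu> y) s)"
  have ball: "K * (epowr (wolff_tail a b t \<mu> x) (s * a) * g t)
     \<le> epowr (emeasure ?\<nu> (ball x t)) a * ennreal (t powr (- b - 1))" if "d < t" for t
  proof -
    have "epowr (ennreal (2 powr (- b)) * wolff_tail a b t \<mu> x) s \<le> epowr (wolff_tail a b d \<mu> y) s" if "y \<in> ball x t" for y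
    proof (intro epowr_mono)
      have "wolff_tail a b t \<mu> x \<le> ennreal (2 powr b) * wolff_tail a b t \<mu> y"
        using that \<open>0 < a\<close> by (intro wolff_tail_shift) (auto simp: dist_commute)
      then have "ennreal (2 powr (- b)) * wolff_tail a b t \<mu> x \<le> ennreal (2 powr (- b)) * (ennreal (2 powr b) * wolff_tail a b t \<mu> y)"
        by (intro mult_left_mono) auto
      also have "\<dots> = wolff_tail a b t \<mu> y"
        by (simp add: mult.assoc[symmetric] ennreal_mult[symmetric] powr_add[symmetric])
      also have "\<dots> \<le> wolff_tail a b d \<mu> y"
        using \<open>d < t\<close> by (intro wolff_tail_antimono) simp
      finally show "ennreal (2 powr (- b)) * wolff_tail a b t \<mu> x \<le> wolff_tail a b d \<mu> y" .
    qed (use \<open>0 < s\<close> in simp)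
    then have "epowr (ennreal (2 powr (- b)) * wolff_tail a b t \<mu> x) s * emeasure \<mu> (ball x t) \<le> emeasure ?\<nu> (ball x t)"
      by (intro emeasure_density_ge) auto
    then have "epowr (epowr (ennreal (2 powr (- b)) * wolff_tail a b t \<mu> x) s * emeasure \<mu> (ball x t)) a * ennreal (t powr (- b - 1))
        \<le> epowr (emeasure ?\<nu> (ball x t)) a * ennreal (t powr (- b - 1))"
      using \<open>0 < a\<close> by (intro mult_right_mono epowr_mono) auto
    then show ?thesis
      using assms by (simp add: epowr_mult epowr_epowr K_def g_def epowr_ennreal powr_powr mult_ac)
  qed
  have "ennreal (2 powr (- b * s * a - s * a - 1)) * epowr (wolff_tail a b d \<mu> x) (s * a + 1)
    = K * (ennreal ((1 / 2) powr (s * a + 1)) * epowr (wolff_tail a b d \<mu> x) (s * a + 1))"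
  proof -
    have "2 powr (- b * s * a - s * a - 1) = 2 powr (- b * s * a) * (1 / 2) powr (s * a + 1)"
      by (simp add: powr_divide powr_add powr_diff)
    then show ?thesis
      by (simp add: K_def ennreal_mult mult.assoc)
  qed
  also have "\<dots> \<le> K * (\<integral>\<^sup>+ t\<in>{d<..}. epowr (wolff_tail a b t \<mu> x) (s * a) * g t \<partial>lborel)"
    using nn_integral_tail_power_ge[of g "s * a" d] assms(2,3)
    by (intro mult_left_mono) (auto simp: wolff_tail_def g_def)
  also have "\<dots> = (\<integral>\<^sup>+ t\<in>{d<..}. K * (epowr (wolff_tail a b t \<mu> x) (s * a) * g t) \<partial>lborel)"
  proof -
    \<comment> \<open>The tail is rewritten as a parametric integral of a jointly measurable kernel,
      which makes it measurable in the truncation radius \<open>t\<close>.\<close>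
    have "(\<lambda>t. \<integral>\<^sup>+ r. g r * (if t < r then 1 else 0) \<partial>lborel) \<in> borel_measurable borel"
      by measurable
    moreover have "(\<lambda>t. \<integral>\<^sup>+ r. g r * (if t < r then 1 else 0) \<partial>lborel) = (\<lambda>t. wolff_tail a b t \<mu> x)"
      unfolding wolff_tail_def g_def
      by (intro ext nn_integral_cong) (auto split: split_indicator)
    ultimately have [measurable]: "(\<lambda>t. wolff_tail a b t \<mu> x) \<in> borel_measurable borel"
      by simp
    show ?thesis
      by (subst nn_integral_cmult[symmetric]) (simp_all add: mult.assoc)
  qed
  also have "\<dots> \<le> wolff_tail a b d ?\<nu> x"
    unfolding wolff_tail_def[of a b d ?\<nu>]
    by (intro nn_integral_mono) (auto split: split_indicator intro: ball)
  finally show ?thesis .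
qed

lemma ball_measurable [measurable]: "ball x r \<in> sets borel"
  by simp

text \<open>Radii up to \<open>t\<close> see only the part of \<mu> in \<open>B\<close>; larger
  radii belong to the tail at \<open>t\<close>. This separates a local potential, open to the energy
  estimate, from a far part that is nearly constant in \<open>y\<close>.\<close>

lemma wolff_tail_split:
  fixes \<mu> :: "'a::euclidean_space measure"
  assumes [simp]: "sets \<mu> = sets borel" and "0 \<le> a" "0 \<le> d" "d \<le> t" and sub: "ball y t \<subseteq> B" "B \<in> sets borel"
  shows "wolff_tail a b d \<mu> y \<le> wolff_tail a b d (density \<mu> (indicator B)) y + wolff_tail a b t \<mu> y"
proof -
  let ?g = "\<lambda>\<mu> r. epowr (emeasure \<mu> (ball y r)) a * ennreal (r powr (- b - 1))"
  have "wolff_tail a b d \<mu> y \<le> (\<integral>\<^sup>+ r. ?g (density \<mu> (indicator B)) r * indicator {d<..} r + ?g \<mu> r * indicator {t<..} r \<partial>lborel)"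
    unfolding wolff_tail_def
  proof (rule nn_integral_mono)
    fix r
    have "emeasure (density \<mu> (indicator B)) (ball y r) = emeasure \<mu> (ball y r)" if "r \<le> t"
      using that sub by (subst emeasure_restricted) (auto intro!: arg_cong[of _ _ "emeasure \<mu>"])
    then show "?g \<mu> r * indicator {d<..} r \<le> ?g (density \<mu> (indicator B)) r * indicator {d<..} r + ?g \<mu> r * indicator {t<..} r"
      by (cases "r \<le> t") (auto split: split_indicator)
  qed
  also have "\<dots> = wolff_tail a b d (density \<mu> (indicator B)) y + wolff_tail a b t \<mu> y"
    unfolding wolff_tail_def by (rule nn_integral_add) (auto intro!: borel_measurable_times_ennreal)
  finally show ?thesis .
qed

text \<open>On \<open>ball x t\<close> the potential is at most that of the restriction to
  \<open>ball x (2 * t)\<close> plus a multiple of its value at \<open>x\<close>. The hypothesis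
  \<open>local\<close> integrates the first part to a multiple of the mass of the doubled ball, and
  dilation brings this back to the potential itself; the second part yields the power
  \<open>s * a + 1\<close>.\<close>

lemma wolff_tail_power_upper:
  fixes \<mu> :: "'a::euclidean_space measure"
  assumes [simp, measurable_cong]: "sets \<mu> = sets borel" and "0 < a" "0 < s" "0 \<le> d" "0 \<le> c"
    and local: "\<And>x r. (\<integral>\<^sup>+ y\<in>ball x r. epowr (wolff_tail a b d (density \<mu> (indicator (ball x r))) y) s \<partial>\<mu>)
      \<le> ennreal c * emeasure \<mu> (ball x r)"
  shows "wolff_tail a b d (density \<mu> (\<lambda>y. epowr (wolff_tail a b d \<mu> y) s)) x
    \<le> ennreal (2 powr (s * a + a) * (c powr a * 2 powr b + 2 powr (b * s * a)))
      * (wolff_tail a b d \<mu> x + epowr (wolff_tail a b d \<mu> x) (s * a + 1))"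
proof -
  let ?\<nu> = "density \<mu> (\<lambda>y. epowr (wolff_tail a b d \<mu> y) s)"
  let ?W = "wolff_tail a b d \<mu> x"
  \<comment> \<open>The common factor \<open>2 powr (s * a + a)\<close> comes from two uses of
    \<open>epowr_plus_le\<close>, with exponent \<open>s\<close> (then raised to \<open>a\<close>)
    and with exponent \<open>a\<close>. \<open>C2\<close> also carries the shift factor
    \<open>2 powr b\<close>, raised to \<open>s * a\<close>.\<close>
  define C1 where "C1 = ennreal (2 powr (s * a + a) * c powr a)"
  define C2 where "C2 = ennreal (2 powr (s * a + a) * 2 powr (b * s * a))"
  have ball: "epowr (emeasure ?\<nu> (ball x t)) a
      \<le> C1 * epowr (emeasure \<mu> (ball x (2 * t))) a + C2 * epowr ?W (s * a) * epowr (emeasure \<mu> (ball x t)) a"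
    if "d < t" for t
  proof -
    let ?B = "ball x (2 * t)"
    let ?U = "wolff_tail a b d (density \<mu> (indicator ?B))"
    let ?T = "ennreal (2 powr b) * ?W"
    have pt: "epowr (wolff_tail a b d \<mu> y) s \<le> ennreal (2 powr s) * (epowr (?U y) s + epowr ?T s)" if "y \<in> ball x t" for y
    proof -
      have "ball y t \<subseteq> ?B"
      proof
        fix z assume "z \<in> ball y t"
        then show "z \<in> ?B"
          using dist_triangle[of x z y] \<open>y \<in> ball x t\<close> by simp
      qed
      then have "wolff_tail a b d \<mu> y \<le> ?U y + wolff_tail a b t \<mu> y"
        using assms \<open>d < t\<close> by (intro wolff_tail_split) auto
      also have "wolff_tail a b t \<mu> y \<le> ennreal (2 powr b) * wolff_tail a b t \<mu> x"
        using that assms by (intro wolff_tail_shift) auto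
      also have "\<dots> \<le> ?T"
        using \<open>d < t\<close> by (intro mult_left_mono wolff_tail_antimono) auto
      finally have "wolff_tail a b d \<mu> y \<le> ?U y + ?T"
        by (simp add: add_left_mono)
      then have "epowr (wolff_tail a b d \<mu> y) s \<le> epowr (?U y + ?T) s"
        using assms by (intro epowr_mono) auto
      also have "\<dots> \<le> ennreal (2 powr s) * (epowr (?U y) s + epowr ?T s)"
        using assms by (intro epowr_plus_le)
      finally show ?thesis .
    qed
    have sets_U: "sets (density \<mu> (indicator ?B)) = sets borel"
      by simp
    note [measurable] = borel_measurable_wolff_tail[OF sets_U]
    have "emeasure ?\<nu> (ball x t) = (\<integral>\<^sup>+ y\<in>ball x t. epowr (wolff_tail a b d \<mu> y) s \<partial>\<mu>)"
      by (simp add: emeasure_density)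
    also have "\<dots> \<le> (\<integral>\<^sup>+ y. ennreal (2 powr s) * (epowr (?U y) s * indicator ?B y + epowr ?T s * indicator (ball x t) y) \<partial>\<mu>)"
    proof (intro nn_integral_mono)
      fix y
      show "epowr (wolff_tail a b d \<mu> y) s * indicator (ball x t) y
        \<le> ennreal (2 powr s) * (epowr (?U y) s * indicator ?B y + epowr ?T s * indicator (ball x t) y)"
        using pt[of y] \<open>0 \<le> d\<close> \<open>d < t\<close> by (cases "y \<in> ball x t") auto
    qed
    also have "\<dots> = ennreal (2 powr s) * ((\<integral>\<^sup>+ y\<in>?B. epowr (?U y) s \<partial>\<mu>) + epowr ?T s * emeasure \<mu> (ball x t))"
      by (simp add: nn_integral_cmult nn_integral_add)
    also have "\<dots> \<le> ennreal (2 powr s) * (ennreal c * emeasure \<mu> ?B + epowr ?T s * emeasure \<mu> (ball x t))"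
      by (intro mult_left_mono add_right_mono local) auto
    finally have "epowr (emeasure ?\<nu> (ball x t)) a
        \<le> epowr (ennreal (2 powr s) * (ennreal c * emeasure \<mu> ?B + epowr ?T s * emeasure \<mu> (ball x t))) a"
      using assms by (intro epowr_mono) auto
    also have "\<dots> \<le> ennreal ((2 powr s) powr a) * (ennreal (2 powr a) *
        (epowr (ennreal c * emeasure \<mu> ?B) a + epowr (epowr ?T s * emeasure \<mu> (ball x t)) a))"
      unfolding epowr_mult[OF \<open>0 < a\<close>, of "ennreal (2 powr s)"] epowr_ennreal[OF powr_ge_zero]
      using assms by (intro mult_left_mono epowr_plus_le) auto
    also have "\<dots> = C1 * epowr (emeasure \<mu> ?B) a + C2 * epowr ?W (s * a) * epowr (emeasure \<mu> (ball x t)) a"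
      using assms by (simp add: C1_def C2_def epowr_mult epowr_ennreal epowr_epowr powr_powr powr_add
          ennreal_mult ring_distribs mult_ac)
    finally show ?thesis .
  qed
  let ?g = "\<lambda>t. epowr (emeasure \<mu> (ball x t)) a * ennreal (t powr (- b - 1))"
  let ?g2 = "\<lambda>t. epowr (emeasure \<mu> (ball x (2 * t))) a * ennreal (t powr (- b - 1))"
  have "wolff_tail a b d ?\<nu> x
      \<le> (\<integral>\<^sup>+ t. C1 * (?g2 t * indicator {d<..} t) + (C2 * epowr ?W (s * a)) * (?g t * indicator {d<..} t) \<partial>lborel)"
    unfolding wolff_tail_def[of a b d ?\<nu>]
  proof (intro nn_integral_mono)
    fix t
    show "epowr (emeasure ?\<nu> (ball x t)) a * ennreal (t powr (- b - 1)) * indicator {d<..} t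
      \<le> C1 * (?g2 t * indicator {d<..} t) + (C2 * epowr ?W (s * a)) * (?g t * indicator {d<..} t)"
    proof (cases "d < t")
      case True
      from mult_right_mono[OF ball[OF True], of "ennreal (t powr (- b - 1))"] True show ?thesis
        by (simp add: ring_distribs mult_ac)
    qed simp
  qed
  also have "\<dots> = C1 * (\<integral>\<^sup>+ t\<in>{d<..}. ?g2 t \<partial>lborel) + C2 * epowr ?W (s * a) * ?W"
    unfolding wolff_tail_def by (simp add: nn_integral_add nn_integral_cmult)
  also have "(\<integral>\<^sup>+ t\<in>{d<..}. ?g2 t \<partial>lborel) \<le> ennreal (2 powr b) * ?W"
    using assms by (subst wolff_tail_dilate) (auto intro!: mult_left_mono wolff_tail_antimono)
  also have "C2 * epowr ?W (s * a) * ?W = C2 * epowr ?W (s * a + 1)"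
    by (simp add: epowr_add_exp mult.assoc)
  also have "C1 * (ennreal (2 powr b) * ?W) + C2 * epowr ?W (s * a + 1)
      \<le> ennreal (2 powr (s * a + a) * (c powr a * 2 powr b + 2 powr (b * s * a))) * (?W + epowr ?W (s * a + 1))"
  proof -
    have "ennreal (2 powr (s * a + a) * (c powr a * 2 powr b + 2 powr (b * s * a))) = C1 * ennreal (2 powr b) + C2"
      unfolding C1_def C2_def
      by (simp add: ennreal_mult[symmetric] ennreal_plus[symmetric] ring_distribs mult_ac del: ennreal_plus)
    then show ?thesis
      by (simp add: ring_distribs mult_ac add_ac add_increasing2 add_increasing add_left_mono add_right_mono)
  qed
  finally show ?thesis
    by (simp add: mult_left_mono add_right_mono)
qed

section \<open>Capacity of superlevel sets\<close>

lemma pair_sigma_finite_lborel: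
  fixes \<nu> :: "'a::euclidean_space measure"
  assumes "sets \<nu> = sets borel" "emeasure \<nu> UNIV < top"
  shows "pair_sigma_finite (lborel :: 'b::euclidean_space measure) \<nu>"
proof -
  interpret \<nu>: finite_measure \<nu>
    using assms sets_eq_imp_space_eq[OF assms(1)] by (intro finite_measureI) auto
  show ?thesis
    by (simp add: pair_sigma_finite_def sigma_finite_lborel \<nu>.sigma_finite_measure_axioms)
qed

text \<open>One factor of the power is written as an integral over the points \<open>z\<close> with
  \<open>dist y z < t\<close>; for them \<open>ball y t\<close> lies in
  \<open>ball z (2 * t)\<close>, which bounds the other factor. After exchanging the integrals, the
  one in \<open>y\<close> is the volume of a ball.\<close>

lemma nn_integral_emeasure_ball_power:
  fixes \<nu> :: "'a::euclidean_space measure"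
  assumes [simp, measurable_cong]: "sets \<nu> = sets borel" and fin: "emeasure \<nu> UNIV < top" and "0 \<le> a" "0 \<le> t"
  shows "(\<integral>\<^sup>+ y. epowr (emeasure \<nu> (ball y t)) (a + 1) \<partial>lborel)
    \<le> ennreal (unit_ball_vol DIM('a) * t ^ DIM('a)) * (\<integral>\<^sup>+ z. epowr (emeasure \<nu> (ball z (2 * t))) a \<partial>\<nu>)"
proof -
  interpret pair_sigma_finite "lborel :: 'a measure" \<nu>
    using pair_sigma_finite_lborel[OF assms(1,2)] .
  let ?I = "\<lambda>y z. (if dist y z < t then 1 else 0) :: ennreal"
  have eq: "emeasure \<nu> (ball y t) = (\<integral>\<^sup>+ z. ?I y z \<partial>\<nu>)" for y
  proof -
    have "(\<integral>\<^sup>+ z. ?I y z \<partial>\<nu>) = (\<integral>\<^sup>+ z. indicator (ball y t) z \<partial>\<nu>)"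
      by (intro nn_integral_cong) (auto split: split_indicator)
    then show ?thesis by simp
  qed
  have "(\<integral>\<^sup>+ y. epowr (emeasure \<nu> (ball y t)) (a + 1) \<partial>lborel)
     = (\<integral>\<^sup>+ y. \<integral>\<^sup>+ z. epowr (emeasure \<nu> (ball y t)) a * ?I y z \<partial>\<nu> \<partial>lborel)"
    by (simp add: nn_integral_cmult epowr_add_exp eq[symmetric])
  also have "\<dots> \<le> (\<integral>\<^sup>+ y. \<integral>\<^sup>+ z. epowr (emeasure \<nu> (ball z (2 * t))) a * ?I y z \<partial>\<nu> \<partial>lborel)"
  proof (intro nn_integral_mono)
    fix y z :: 'a
    have "ball y t \<subseteq> ball z (2 * t)" if "dist y z < t"
    proof
      fix w assume "w \<in> ball y t"
      then show "w \<in> ball z (2 * t)"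
        using dist_triangle3[of z w y] that by simp
    qed
    then show "epowr (emeasure \<nu> (ball y t)) a * ?I y z \<le> epowr (emeasure \<nu> (ball z (2 * t))) a * ?I y z"
      using \<open>0 \<le> a\<close> by (auto intro!: epowr_mono emeasure_mono)
  qed
  also have "\<dots> = (\<integral>\<^sup>+ z. \<integral>\<^sup>+ y. epowr (emeasure \<nu> (ball z (2 * t))) a * ?I y z \<partial>lborel \<partial>\<nu>)"
    by (rule Fubini'[symmetric]) measurable
  also have "\<dots> = (\<integral>\<^sup>+ z. epowr (emeasure \<nu> (ball z (2 * t))) a * ennreal (unit_ball_vol DIM('a) * t ^ DIM('a)) \<partial>\<nu>)"
  proof (intro nn_integral_cong)
    fix z :: 'a
    have "(\<integral>\<^sup>+ y. ?I y z \<partial>lborel) = emeasure lborel (ball z t)"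
    proof -
      have "(\<integral>\<^sup>+ y. ?I y z \<partial>lborel) = (\<integral>\<^sup>+ y. indicator (ball z t) y \<partial>lborel)"
        by (intro nn_integral_cong) (auto split: split_indicator simp: dist_commute)
      then show ?thesis by simp
    qed
    also have "\<dots> = ennreal (unit_ball_vol DIM('a) * t ^ DIM('a))"
      using \<open>0 \<le> t\<close> by (rule emeasure_ball)
    finally show "(\<integral>\<^sup>+ y. epowr (emeasure \<nu> (ball z (2 * t))) a * ?I y z \<partial>lborel)
      = epowr (emeasure \<nu> (ball z (2 * t))) a * ennreal (unit_ball_vol DIM('a) * t ^ DIM('a))"
      by (simp add: nn_integral_cmult)
  qed
  also have "\<dots> = ennreal (unit_ball_vol DIM('a) * t ^ DIM('a)) * (\<integral>\<^sup>+ z. epowr (emeasure \<nu> (ball z (2 * t))) a \<partial>\<nu>)"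
    by (subst mult.commute) (rule nn_integral_cmult, measurable)
  finally show ?thesis .
qed

text \<open>\<open>nn_integral_emeasure_ball_power\<close> is integrated over the radii. The volume
  factor \<open>t ^ DIM('a)\<close> cancels the extra \<open>DIM('a)\<close> in the weight, and the
  doubled radius produces \<open>2 powr b\<close> and the truncation at
  \<open>2 * d\<close>.\<close>

lemma nn_integral_wolff_tail_lborel_le:
  fixes \<nu> :: "'a::euclidean_space measure"
  assumes [simp, measurable_cong]: "sets \<nu> = sets borel" and fin: "emeasure \<nu> UNIV < top" and "0 \<le> a" "0 \<le> d"
  shows "(\<integral>\<^sup>+ y. wolff_tail (a + 1) (b + real DIM('a)) d \<nu> y \<partial>lborel)
    \<le> ennreal (unit_ball_vol DIM('a) * 2 powr b) * (\<integral>\<^sup>+ z. wolff_tail a b (2 * d) \<nu> z \<partial>\<nu>)"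
proof -
  let ?n = "real DIM('a)" and ?\<omega> = "unit_ball_vol (real DIM('a))"
  interpret pair_sigma_finite "lborel :: real measure" \<nu>
    using pair_sigma_finite_lborel[OF assms(1,2)] .
  have "(\<integral>\<^sup>+ y. wolff_tail (a + 1) (b + ?n) d \<nu> y \<partial>lborel)
    = (\<integral>\<^sup>+ t. (\<integral>\<^sup>+ y. epowr (emeasure \<nu> (ball y t)) (a + 1) * ennreal (t powr (- (b + ?n) - 1)) * (if d < t then 1 else 0) \<partial>lborel) \<partial>lborel)"
    unfolding wolff_tail_def indicator_def greaterThan_iff of_bool_def
    by (rule lborel_pair.Fubini'[symmetric]) measurable
  also have "\<dots> = (\<integral>\<^sup>+ t. (\<integral>\<^sup>+ y. epowr (emeasure \<nu> (ball y t)) (a + 1) \<partial>lborel) * (ennreal (t powr (- (b + ?n) - 1)) * (if d < t then 1 else 0)) \<partial>lborel)"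
    by (intro nn_integral_cong) (simp add: mult.assoc nn_integral_multc)
  also have "\<dots> \<le> (\<integral>\<^sup>+ t. ennreal ?\<omega> * (\<integral>\<^sup>+ z. epowr (emeasure \<nu> (ball z (2 * t))) a * ennreal (t powr (- b - 1)) * (if d < t then 1 else 0) \<partial>\<nu>) \<partial>lborel)"
  proof (intro nn_integral_mono)
    fix t :: real
    show "(\<integral>\<^sup>+ y. epowr (emeasure \<nu> (ball y t)) (a + 1) \<partial>lborel) * (ennreal (t powr (- (b + ?n) - 1)) * (if d < t then 1 else 0))
      \<le> ennreal ?\<omega> * (\<integral>\<^sup>+ z. epowr (emeasure \<nu> (ball z (2 * t))) a * ennreal (t powr (- b - 1)) * (if d < t then 1 else 0) \<partial>\<nu>)"
    proof (cases "d < t")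
      case True
      with \<open>0 \<le> d\<close> have "0 < t" by simp
      let ?J = "\<integral>\<^sup>+ z. epowr (emeasure \<nu> (ball z (2 * t))) a \<partial>\<nu>"
      have "(\<integral>\<^sup>+ y. epowr (emeasure \<nu> (ball y t)) (a + 1) \<partial>lborel) * ennreal (t powr (- (b + ?n) - 1))
        \<le> ennreal (?\<omega> * t ^ DIM('a)) * ?J * ennreal (t powr (- (b + ?n) - 1))"
        using assms \<open>0 < t\<close> by (intro mult_right_mono nn_integral_emeasure_ball_power) auto
      also have "\<dots> = ennreal (?\<omega> * (t ^ DIM('a) * t powr (- (b + ?n) - 1))) * ?J"
        using \<open>0 < t\<close> by (simp add: ennreal_mult mult_ac)
      also have "t ^ DIM('a) * t powr (- (b + ?n) - 1) = t powr (- b - 1)"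
        using \<open>0 < t\<close> by (simp add: powr_realpow[symmetric] powr_add[symmetric])
      also have "ennreal (?\<omega> * t powr (- b - 1)) * ?J = ennreal ?\<omega> * (\<integral>\<^sup>+ z. epowr (emeasure \<nu> (ball z (2 * t))) a * ennreal (t powr (- b - 1)) \<partial>\<nu>)"
      proof -
        have "(\<integral>\<^sup>+ z. epowr (emeasure \<nu> (ball z (2 * t))) a * ennreal (t powr (- b - 1)) \<partial>\<nu>) = ?J * ennreal (t powr (- b - 1))"
          by (rule nn_integral_multc) measurable
        then show ?thesis
          by (simp add: ennreal_mult mult_ac)
      qed
      finally show ?thesis
        using True by simp
    qed simp
  qed
  also have "\<dots> = ennreal ?\<omega> * (\<integral>\<^sup>+ t. (\<integral>\<^sup>+ z. epowr (emeasure \<nu> (ball z (2 * t))) a * ennreal (t powr (- b - 1)) * (if d < t then 1 else 0) \<partial>\<nu>) \<partial>lborel)"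
    by (rule nn_integral_cmult) measurable
  also have "(\<integral>\<^sup>+ t. (\<integral>\<^sup>+ z. epowr (emeasure \<nu> (ball z (2 * t))) a * ennreal (t powr (- b - 1)) * (if d < t then 1 else 0) \<partial>\<nu>) \<partial>lborel)
     = (\<integral>\<^sup>+ z. (\<integral>\<^sup>+ t. epowr (emeasure \<nu> (ball z (2 * t))) a * ennreal (t powr (- b - 1)) * (if d < t then 1 else 0) \<partial>lborel) \<partial>\<nu>)"
    by (rule Fubini'[symmetric]) measurable
  also have "\<dots> = (\<integral>\<^sup>+ z. ennreal (2 powr b) * wolff_tail a b (2 * d) \<nu> z \<partial>\<nu>)"
    using wolff_tail_dilate[OF assms(1) \<open>0 \<le> d\<close>, of _ a b]
    by (simp add: indicator_def of_bool_def)
  also have "\<dots> = ennreal (2 powr b) * (\<integral>\<^sup>+ z. wolff_tail a b (2 * d) \<nu> z \<partial>\<nu>)"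
    by (rule nn_integral_cmult) measurable
  finally show ?thesis
    by (simp add: ennreal_mult mult.assoc)
qed

text \<open>Radii between \<open>2 * r\<close> and \<open>4 * r\<close> suffice: for them
  \<open>ball y t\<close> contains \<open>ball x r\<close>, the weight is at least its value at
  \<open>4 * r\<close>, and the interval has length \<open>2 * r\<close>.\<close>

lemma wolff_tail_ge_emeasure_ball:
  fixes \<nu> :: "'a::euclidean_space measure"
  assumes [simp]: "sets \<nu> = sets borel" and "0 \<le> a" "-1 \<le> e" "0 \<le> d" "d < r" "y \<in> ball x r"
  shows "ennreal (2 * 4 powr (- e - 1) * r powr (- e)) * epowr (emeasure \<nu> (ball x r)) a \<le> wolff_tail a e (2 * d) \<nu> y"
proof -
  have "0 < r" using assms by simp
  let ?m = "epowr (emeasure \<nu> (ball x r)) a * ennreal ((4 * r) powr (- e - 1))"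
  have "?m * emeasure lborel {2 * r<..<4 * r} = (\<integral>\<^sup>+ t. ?m * indicator {2 * r<..<4 * r} t \<partial>lborel)"
    by (simp add: nn_integral_cmult_indicator)
  also have "\<dots> \<le> wolff_tail a e (2 * d) \<nu> y"
    unfolding wolff_tail_def
  proof (intro nn_integral_mono)
    fix t
    show "?m * indicator {2 * r<..<4 * r} t \<le> epowr (emeasure \<nu> (ball y t)) a * ennreal (t powr (- e - 1)) * indicator {2 * d<..} t"
    proof (cases "t \<in> {2 * r<..<4 * r}")
      case True
      have "ball x r \<subseteq> ball y t"
      proof
        fix z assume "z \<in> ball x r"
        then show "z \<in> ball y t"
          using dist_triangle3[of y z x] True assms(6) by simp
      qed
      then have "epowr (emeasure \<nu> (ball x r)) a \<le> epowr (emeasure \<nu> (ball y t)) a"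
        using assms(2) by (intro epowr_mono emeasure_mono) auto
      moreover have "(4 * r) powr (- e - 1) \<le> t powr (- e - 1)"
        using True \<open>0 < r\<close> \<open>-1 \<le> e\<close> by (intro powr_mono2') auto
      ultimately show ?thesis
        using True assms by (auto intro!: mult_mono ennreal_leI)
    qed simp
  qed
  also have "?m * emeasure lborel {2 * r<..<4 * r} = ennreal (2 * 4 powr (- e - 1) * r powr (- e)) * epowr (emeasure \<nu> (ball x r)) a"
  proof -
    have "(4 * r) powr (- e - 1) * (2 * r) = 2 * 4 powr (- e - 1) * (r powr (- e - 1) * r powr 1)"
      using \<open>0 < r\<close> by (simp add: powr_mult)
    also have "r powr (- e - 1) * r powr 1 = r powr (- e)"
      by (simp only: powr_add[symmetric]) simp
    finally have *: "(4 * r) powr (- e - 1) * (2 * r) = 2 * 4 powr (- e - 1) * r powr (- e)" .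
    have "?m * emeasure lborel {2 * r<..<4 * r} = ennreal ((4 * r) powr (- e - 1) * (2 * r)) * epowr (emeasure \<nu> (ball x r)) a"
      using \<open>0 < r\<close> by (simp add: ennreal_mult mult_ac)
    then show ?thesis
      unfolding * .
  qed
  finally show ?thesis .
qed

text \<open>The test function is \<open>f = g\<^sup>1\<^sup>/\<^sup>p\<close> for a Wolff type potential \<open>g\<close> with exponent
  \<open>p / (p - 1)\<close>: Fubini turns its \<open>L\<^sup>p\<close> norm into the Wolff energy, so that Wolff's inequality
  is not needed, and integrating over \<open>2 * r < t < 4 * r\<close> shows that its Riesz potential
  dominates the Wolff potential.\<close>

lemma cap_wolff_superlevel:
  fixes p \<alpha> :: real
  defines "n \<equiv> real DIM('a::euclidean_space)"
  assumes "1 < p" "0 < \<alpha>" "\<alpha> < n / p"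
  defines "a \<equiv> 1 / (p - 1)" and "b \<equiv> (n - \<alpha> * p) / (p - 1)"
  shows "\<exists>K\<ge>0. \<forall>\<nu> :: 'a measure. \<forall>d l E. sets \<nu> = sets borel \<longrightarrow> emeasure \<nu> UNIV < top \<longrightarrow> 0 < d \<longrightarrow> 0 < l \<longrightarrow>
     (\<forall>x\<in>E. ennreal l \<le> wolff_tail a b d \<nu> x) \<longrightarrow>
     cap \<alpha> p E \<le> ennreal (K * l powr (- p)) * (\<integral>\<^sup>+ z. wolff_tail a b d \<nu> z \<partial>\<nu>)"
proof -
  define \<omega> where "\<omega> = unit_ball_vol n"
  have "0 < \<omega>" by (simp add: \<omega>_def n_def)
  have "0 < a" using assms by (simp add: a_def)
  have "\<alpha> * p < n" using assms by (simp add: field_simps)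
  then have "0 < b" using assms by (simp add: b_def)
  have "0 < n" by (simp add: n_def)
  \<comment> \<open>\<open>e\<close> is the weight exponent of the test potential, \<open>k\<close>
    the \<open>p\<close>-th root of the constant in \<open>wolff_tail_ge_emeasure_ball\<close>, and
    \<open>K\<close> what remains of the normalization and of the Fubini estimate.\<close>
  define e where "e = b + n"
  define k where "k = (2 * 4 powr (- e - 1)) powr (1 / p)"
  define K where "K = (k * \<omega>) powr (- p) * \<omega> * 2 powr b"
  have "0 < k" by (simp add: k_def)
  \<comment> \<open>The two identities match the powers of mass and radius: the \<open>p\<close>-th
    root of the test potential, integrated over a ball and weighted as in the Riesz potential,
    reproduces the Wolff integrand.\<close>
  have ap: "(a + 1) * (1 / p) = a"
    using assms(2) by (simp add: a_def field_simps)
  have ep: "n - e * (1 / p) - (n - \<alpha>) - 1 = - b - 1"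
    using assms(2) by (simp add: e_def b_def field_simps)
  show ?thesis
  proof (intro exI[of _ K] conjI allI impI)
    show "0 \<le> K" using \<open>0 < \<omega>\<close> by (simp add: K_def)
  next
    fix \<nu> :: "'a measure" and d l E
    assume [simp, measurable_cong]: "sets \<nu> = sets borel" and fin: "emeasure \<nu> UNIV < top" and "0 < d" "0 < l"
      and E: "\<forall>x\<in>E. ennreal l \<le> wolff_tail a b d \<nu> x"
    \<comment> \<open>Truncation at \<open>2 * d\<close> fits all radii \<open>r > d\<close>,
      because the lower bound for \<open>g\<close> uses radii above \<open>2 * r\<close>. Dividing
      by \<open>l * k * \<omega>\<close> normalizes the Riesz potential to at least one where the
      Wolff potential is at least \<open>l\<close>.\<close>
    define g where "g = wolff_tail (a + 1) e (2 * d) \<nu>"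
    define f where "f y = enn2real (g y) powr (1 / p) / (l * k * \<omega>)" for y
    have [measurable]: "g \<in> borel_measurable borel"
      unfolding g_def by measurable
    have g_fin: "g y < top" for y
      unfolding g_def using \<open>0 < d\<close> \<open>0 < a\<close> \<open>0 < b\<close> \<open>0 < n\<close> fin
      by (intro wolff_tail_finite) (auto simp: e_def)
    have f_pow: "ennreal (f y powr p) = ennreal ((l * k * \<omega>) powr (- p)) * g y" for y
    proof -
      have "f y powr p = (l * k * \<omega>) powr (- p) * enn2real (g y)"
        unfolding f_def using \<open>0 < l\<close> \<open>0 < k\<close> \<open>0 < \<omega>\<close> \<open>1 < p\<close>
        by (simp add: powr_divide powr_powr powr_minus_divide)
      then show ?thesis
        using g_fin[of y] by (simp add: ennreal_mult ennreal_enn2real_if)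
    qed
    have "(\<integral>\<^sup>+ y. ennreal (f y powr p) \<partial>lebesgue) = ennreal ((l * k * \<omega>) powr (- p)) * (\<integral>\<^sup>+ y. g y \<partial>lborel)"
      unfolding f_pow nn_integral_completion by (rule nn_integral_cmult) simp
    also have "\<dots> \<le> ennreal ((l * k * \<omega>) powr (- p)) * (ennreal (\<omega> * 2 powr b) * (\<integral>\<^sup>+ z. wolff_tail a b (2 * (2 * d)) \<nu> z \<partial>\<nu>))"
      unfolding g_def e_def n_def \<omega>_def using \<open>0 < a\<close> \<open>0 < d\<close> fin
      by (intro mult_left_mono nn_integral_wolff_tail_lborel_le) auto
    also have "\<dots> = ennreal (K * l powr (- p)) * (\<integral>\<^sup>+ z. wolff_tail a b (2 * (2 * d)) \<nu> z \<partial>\<nu>)"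
      using \<open>0 < l\<close> \<open>0 < k\<close> \<open>0 < \<omega>\<close> by (simp add: K_def powr_mult ennreal_mult mult_ac)
    also have "\<dots> \<le> ennreal (K * l powr (- p)) * (\<integral>\<^sup>+ z. wolff_tail a b d \<nu> z \<partial>\<nu>)"
      using \<open>0 < d\<close> by (intro mult_left_mono nn_integral_mono wolff_tail_antimono) auto
    finally have norm: "(\<integral>\<^sup>+ y. ennreal (f y powr p) \<partial>lebesgue) \<le> ennreal (K * l powr (- p)) * (\<integral>\<^sup>+ z. wolff_tail a b d \<nu> z \<partial>\<nu>)" .
    have "(\<integral>\<^sup>+ z. wolff_tail a b d \<nu> z \<partial>\<nu>) \<le> (\<integral>\<^sup>+ z. epowr (emeasure \<nu> UNIV) a * ennreal (d powr (- b) / b) \<partial>\<nu>)"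
      using \<open>0 < a\<close> \<open>0 < b\<close> \<open>0 < d\<close> by (intro nn_integral_mono wolff_tail_le) auto
    also have "\<dots> < top"
      using fin epowr_less_top[OF fin, of a] sets_eq_imp_space_eq[of \<nu> borel] by (simp add: ennreal_mult_less_top)
    finally have "ennreal (K * l powr (- p)) * (\<integral>\<^sup>+ z. wolff_tail a b d \<nu> z \<partial>\<nu>) < top"
      by (simp add: ennreal_mult_less_top)
    \<comment> \<open>Only functions of finite norm compete in \<open>cap\<close>; boundedness of
      the truncated potential and finite mass of \<nu> provide this.\<close>
    with norm have norm_fin: "(\<integral>\<^sup>+ y. ennreal (f y powr p) \<partial>lebesgue) < \<infinity>"
      by (simp add: le_less_trans)
    have riesz: "1 \<le> riesz_pot \<alpha> f x" if "x \<in> E" for x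
    proof -
      \<comment> \<open>The comparison is made radius by radius: on \<open>ball x r\<close> the
        function \<open>f\<close> is bounded below by a constant, whose integral brings in the
        volume \<open>\<omega> * r powr n\<close>.\<close>
      have lower: "ennreal (1 / l) * (epowr (emeasure \<nu> (ball x r)) a * ennreal (r powr (- b - 1)))
         \<le> (\<integral>\<^sup>+ y\<in>ball x r. ennreal (f y) \<partial>lebesgue) / ennreal (r powr (n - \<alpha>)) * ennreal (1 / r)" if "d < r" for r
      proof -
        have "0 < r" using \<open>0 < d\<close> that by simp
        let ?m = "epowr (emeasure \<nu> (ball x r)) a"
        have f_lower: "ennreal (r powr (- e * (1 / p)) / (l * \<omega>)) * ?m \<le> ennreal (f y)" if y: "y \<in> ball x r" for y
        proof -
          have "epowr (ennreal (2 * 4 powr (- e - 1) * r powr (- e)) * epowr (emeasure \<nu> (ball x r)) (a + 1)) (1 / p) \<le> epowr (g y) (1 / p)"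
            unfolding g_def using \<open>0 < a\<close> \<open>0 < d\<close> \<open>d < r\<close> y \<open>1 < p\<close> \<open>0 < n\<close> \<open>0 < b\<close>
            by (intro epowr_mono wolff_tail_ge_emeasure_ball) (auto simp: e_def)
          also have "epowr (g y) (1 / p) = ennreal (enn2real (g y) powr (1 / p))"
            using g_fin[of y] by (simp add: epowr_def)
          also have "epowr (ennreal (2 * 4 powr (- e - 1) * r powr (- e)) * epowr (emeasure \<nu> (ball x r)) (a + 1)) (1 / p)
            = ennreal (k * r powr (- e * (1 / p))) * ?m"
            using \<open>1 < p\<close> ap by (simp add: epowr_mult epowr_ennreal epowr_epowr powr_mult powr_powr k_def)
          finally have "ennreal (1 / (l * k * \<omega>)) * (ennreal (k * r powr (- e * (1 / p))) * ?m)
            \<le> ennreal (1 / (l * k * \<omega>)) * ennreal (enn2real (g y) powr (1 / p))"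
            by (rule mult_left_mono) simp
          moreover have "1 / (l * k * \<omega>) * (k * r powr (- e * (1 / p))) = r powr (- e * (1 / p)) / (l * \<omega>)"
            using \<open>0 < k\<close> by simp
          ultimately show ?thesis
            using \<open>0 < l\<close> \<open>0 < k\<close> \<open>0 < \<omega>\<close> by (simp add: f_def mult.assoc[symmetric] ennreal_mult[symmetric])
        qed
        have "ennreal (r powr (- e * (1 / p)) / (l * \<omega>)) * ?m * ennreal (\<omega> * r powr n)
          = (\<integral>\<^sup>+ y. ennreal (r powr (- e * (1 / p)) / (l * \<omega>)) * ?m * indicator (ball x r) y \<partial>lebesgue)"
          using \<open>0 < r\<close> by (simp add: nn_integral_cmult_indicator emeasure_ball \<omega>_def n_def powr_realpow)
        also have "\<dots> \<le> (\<integral>\<^sup>+ y\<in>ball x r. ennreal (f y) \<partial>lebesgue)"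
          using f_lower by (intro nn_integral_mono) (auto split: split_indicator)
        finally have "ennreal (r powr (- e * (1 / p)) / (l * \<omega>)) * ?m * ennreal (\<omega> * r powr n) / ennreal (r powr (n - \<alpha>)) * ennreal (1 / r)
          \<le> (\<integral>\<^sup>+ y\<in>ball x r. ennreal (f y) \<partial>lebesgue) / ennreal (r powr (n - \<alpha>)) * ennreal (1 / r)"
          by (intro mult_right_mono divide_right_mono_ennreal) auto
        also have "ennreal (r powr (- e * (1 / p)) / (l * \<omega>)) * ?m * ennreal (\<omega> * r powr n) / ennreal (r powr (n - \<alpha>)) * ennreal (1 / r)
          = ennreal (r powr (- e * (1 / p)) / (l * \<omega>) * (\<omega> * r powr n) * (1 / r powr (n - \<alpha>)) * (1 / r)) * ?m"
        proof -
          have *: "ennreal A * m * ennreal B / ennreal D * ennreal z = ennreal (A * B * (1 / D) * z) * m"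
            if "0 \<le> A" "0 \<le> B" "0 < D" "0 \<le> z" for A B D z m
            using that by (simp add: divide_ennreal_def inverse_ennreal ennreal_mult mult_ac inverse_eq_divide del: times_divide_eq_right times_divide_eq_left)
          show ?thesis
            using \<open>0 < r\<close> \<open>0 < l\<close> \<open>0 < \<omega>\<close> by (subst *) simp_all
        qed
        also have "r powr (- e * (1 / p)) / (l * \<omega>) * (\<omega> * r powr n) * (1 / r powr (n - \<alpha>)) * (1 / r)
          = 1 / l * r powr (n - e * (1 / p) - (n - \<alpha>) - 1)"
          using \<open>0 < r\<close> \<open>0 < \<omega>\<close> by (simp add: powr_diff powr_minus powr_add field_simps)
        also have "\<dots> = 1 / l * r powr (- b - 1)"
          by (simp only: ep)
        also have "ennreal (1 / l * r powr (- b - 1)) * ?m = ennreal (1 / l) * (?m * ennreal (r powr (- b - 1)))"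
          using \<open>0 < l\<close> by (subst ennreal_mult) (simp_all add: mult_ac)
        finally show ?thesis .
      qed
      have "1 = ennreal (1 / l) * ennreal l"
        using \<open>0 < l\<close> by (simp add: ennreal_mult[symmetric])
      also have "\<dots> \<le> ennreal (1 / l) * wolff_tail a b d \<nu> x"
        using E that by (intro mult_left_mono) auto
      also have "\<dots> = (\<integral>\<^sup>+ r. ennreal (1 / l) * (epowr (emeasure \<nu> (ball x r)) a * ennreal (r powr (- b - 1)) * indicator {d<..} r) \<partial>lborel)"
        unfolding wolff_tail_def by (rule nn_integral_cmult[symmetric]) measurable
      also have "\<dots> \<le> riesz_pot \<alpha> f x"
        unfolding riesz_pot_def using \<open>0 < d\<close>
        by (intro nn_integral_mono) (auto split: split_indicator intro: lower[unfolded n_def])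
      finally show ?thesis .
    qed
    have "0 \<le> f y" for y
      using \<open>0 < l\<close> \<open>0 < k\<close> \<open>0 < \<omega>\<close> by (simp add: f_def)
    have "cap \<alpha> p E \<le> (\<integral>\<^sup>+ y. ennreal (f y powr p) \<partial>lebesgue)"
      unfolding cap_def
    proof (rule INF_lower, safe)
      show "f \<in> borel_measurable lebesgue"
        unfolding f_def[abs_def] by (intro measurable_completion) measurable
    qed (fact \<open>\<And>y. 0 \<le> f y\<close> norm_fin riesz)+
    also note norm
    finally show "cap \<alpha> p E \<le> ennreal (K * l powr (- p)) * (\<integral>\<^sup>+ z. wolff_tail a b d \<nu> z \<partial>\<nu>)" .
  qed
qed

section \<open>Energy estimates\<close>

text \<open>Values up to \<open>N\<close> contribute at most \<open>N powr m\<close> times the total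
  mass. Above \<open>N\<close> the dyadic levels \<open>2 ^ k * N\<close> and the weak bound give a
  geometric series with ratio \<open>2 powr (- h)\<close>, hence a contribution proportional to
  \<open>N powr (- h)\<close>. For large \<open>N\<close> the integral on the right gets a
  coefficient of at most one half and, being finite, is absorbed.\<close>

lemma nn_integral_power_absorb:
  fixes \<rho> :: "'a \<Rightarrow> ennreal"
  assumes [measurable]: "\<rho> \<in> borel_measurable M"
    and "0 < m" "0 < h" "0 \<le> K"
    and fin: "emeasure M (space M) < top" "(\<integral>\<^sup>+ x. epowr (\<rho> x) m \<partial>M) < top"
    and weak: "\<And>l. 0 < l \<Longrightarrow> emeasure M {x \<in> space M. ennreal l < \<rho> x}
      \<le> ennreal (K * l powr (- (m + h))) * (emeasure M (space M) + (\<integral>\<^sup>+ x. epowr (\<rho> x) m \<partial>M))"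
  shows "(\<integral>\<^sup>+ x. epowr (\<rho> x) m \<partial>M)
    \<le> ennreal (2 * (2 * (2 powr m * K / (1 - 2 powr (- h))) + 1) powr (m / h) + 1) * emeasure M (space M)"
proof -
  define q where "q = (2::real) powr (- h)"
  define c where "c = 2 powr m * K / (1 - q)"
  \<comment> \<open>Chosen so that \<open>c * N powr (- h) = c / (2 * c + 1)\<close>, which is at
    most one half.\<close>
  define N where "N = (2 * c + 1) powr (1 / h)"
  define A where "A = (\<integral>\<^sup>+ x. epowr (\<rho> x) m \<partial>M)"
  define \<mu>1 where "\<mu>1 = emeasure M (space M)"
  have q: "0 < q" "q < 1"
    using \<open>0 < h\<close> by (simp_all add: q_def powr_less_one)
  have "0 \<le> c"
    using q \<open>0 \<le> K\<close> by (simp add: c_def)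
  then have "0 < N" by (simp add: N_def)
  have N_h: "N powr (- h) = 1 / (2 * c + 1)"
    using \<open>0 < h\<close> \<open>0 \<le> c\<close> by (simp add: N_def powr_powr powr_minus_divide)
  have N_m: "N powr m = (2 * c + 1) powr (m / h)"
    by (simp add: N_def powr_powr)
  let ?l = "\<lambda>k::nat. 2 ^ k * N"
  let ?F = "\<lambda>k. {x \<in> space M. ennreal (?l k) < \<rho> x}"
  let ?t = "\<lambda>k x. ennreal ((2 * ?l k) powr m) * indicator (?F k) x"
  have pt: "epowr (\<rho> x) m \<le> ennreal (N powr m) + (\<Sum>k. ?t k x)" if "x \<in> space M" "\<rho> x < top" for x
  proof -
    obtain r where r: "0 \<le> r" "\<rho> x = ennreal r"
      using \<open>\<rho> x < top\<close> by (cases "\<rho> x" rule: ennreal_cases) auto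
    show ?thesis
    proof (cases "r \<le> N")
      case True
      then have "epowr (\<rho> x) m \<le> ennreal (N powr m)"
        using r \<open>0 < m\<close> by (simp add: epowr_ennreal ennreal_leI powr_mono2)
      then show ?thesis
        by (rule order_trans) simp
    next
      case False
      have "\<exists>j. r \<le> ?l j"
      proof -
        obtain j where "r / N < 2 ^ j"
          using real_arch_pow[of 2 "r / N"] by auto
        then show ?thesis
          using \<open>0 < N\<close> by (auto simp: field_simps intro!: exI[of _ j])
      qed
      \<comment> \<open>The least level that reaches \<open>r\<close> is not the first one, so
        \<open>r\<close> lies in a dyadic shell, and a single term of the series dominates.\<close>
      then obtain j where j: "r \<le> ?l j" "\<And>i. i < j \<Longrightarrow> \<not> r \<le> ?l i"
        using exists_least_iff[of "\<lambda>j. r \<le> ?l j"] by blast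
      then obtain k where "j = Suc k"
        using False by (cases j) auto
      with j have k: "?l k < r" "r \<le> 2 * ?l k"
        by (auto simp: not_le)
      have "epowr (\<rho> x) m \<le> ennreal ((2 * ?l k) powr m)"
        using r k \<open>0 < m\<close> by (simp add: epowr_ennreal ennreal_leI powr_mono2)
      also have "\<dots> = ?t k x"
        using k r that \<open>0 < N\<close> by (simp add: ennreal_less_iff)
      also have "\<dots> \<le> (\<Sum>k. ?t k x)"
      proof -
        have "sum (\<lambda>k. ?t k x) {k} \<le> (\<Sum>k. ?t k x)"
          by (rule sum_le_suminf) auto
        then show ?thesis
          by (simp only: sum.insert[OF finite.emptyI] sum.empty empty_iff not_False_eq_True add_0_right)
      qed
      finally show ?thesis
        by (simp add: add_increasing)
    qed
  qed
  have "AE x in M. \<rho> x < top"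
  proof -
    have "AE x in M. epowr (\<rho> x) m \<noteq> \<infinity>"
      using fin(2) by (intro nn_integral_noteq_infinite) auto
    then show ?thesis
      by eventually_elim (auto simp: less_top[symmetric])
  qed
  with AE_space have "AE x in M. epowr (\<rho> x) m \<le> ennreal (N powr m) + (\<Sum>k. ?t k x)"
    by eventually_elim (rule pt)
  then have "A \<le> (\<integral>\<^sup>+ x. ennreal (N powr m) + (\<Sum>k. ?t k x) \<partial>M)"
    unfolding A_def by (rule nn_integral_mono_AE)
  also have "\<dots> = ennreal (N powr m) * \<mu>1 + (\<Sum>k. ennreal ((2 * ?l k) powr m) * emeasure M (?F k))"
    unfolding \<mu>1_def by (simp add: nn_integral_add nn_integral_suminf nn_integral_cmult_indicator)
  also have "\<dots> \<le> ennreal (N powr m) * \<mu>1 + (\<Sum>k. ennreal (2 powr m * K * N powr (- h)) * (\<mu>1 + A) * ennreal (q ^ k))"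
  proof (intro add_left_mono suminf_le summableI)
    fix k
    have "0 < ?l k" using \<open>0 < N\<close> by simp
    have "ennreal ((2 * ?l k) powr m) * emeasure M (?F k) \<le> ennreal ((2 * ?l k) powr m) * (ennreal (K * ?l k powr (- (m + h))) * (\<mu>1 + A))"
      using weak[OF \<open>0 < ?l k\<close>] unfolding \<mu>1_def A_def by (rule mult_left_mono) simp
    also have "\<dots> = ennreal ((2 * ?l k) powr m * (K * ?l k powr (- (m + h)))) * (\<mu>1 + A)"
      using \<open>0 \<le> K\<close> by (simp add: ennreal_mult mult.assoc)
    also have "(2 * ?l k) powr m * (K * ?l k powr (- (m + h))) = 2 powr m * K * (?l k powr m * ?l k powr (- (m + h)))"
      using \<open>0 < N\<close> by (simp add: powr_mult)
    also have "?l k powr m * ?l k powr (- (m + h)) = ?l k powr (- h)"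
      by (simp only: powr_add[symmetric]) simp
    also have "\<dots> = N powr (- h) * q ^ k"
      using \<open>0 < N\<close> by (simp add: powr_mult q_def powr_realpow[symmetric] powr_powr mult_ac)
    finally show "ennreal ((2 * ?l k) powr m) * emeasure M (?F k) \<le> ennreal (2 powr m * K * N powr (- h)) * (\<mu>1 + A) * ennreal (q ^ k)"
      using q \<open>0 \<le> K\<close> by (simp add: ennreal_mult mult_ac)
  qed
  also have "(\<Sum>k. ennreal (2 powr m * K * N powr (- h)) * (\<mu>1 + A) * ennreal (q ^ k)) = ennreal (2 powr m * K * N powr (- h)) * (\<mu>1 + A) * ennreal (1 / (1 - q))"
    using q by (simp add: ennreal_suminf_cmult suminf_ennreal2 suminf_geometric summable_geometric)
  also have "\<dots> = ennreal (c * N powr (- h)) * (\<mu>1 + A)"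
    using q \<open>0 \<le> K\<close> by (simp add: c_def ennreal_mult[symmetric] mult_ac)
  also have "ennreal (c * N powr (- h)) * (\<mu>1 + A) \<le> ennreal (1 / 2) * (\<mu>1 + A)"
    using \<open>0 \<le> c\<close> by (intro mult_right_mono ennreal_leI) (auto simp: N_h field_simps)
  finally have le: "A \<le> ennreal (N powr m) * \<mu>1 + ennreal (1 / 2) * (\<mu>1 + A)"
    by (simp add: add_left_mono)
  obtain x y where xy: "0 \<le> x" "A = ennreal x" "0 \<le> y" "\<mu>1 = ennreal y"
    using fin unfolding A_def \<mu>1_def by (metis ennreal_cases less_irrefl)
  have "ennreal (N powr m) * ennreal y + ennreal (1 / 2) * (ennreal y + ennreal x) = ennreal (N powr m * y + 1 / 2 * (y + x))"
    using xy(1,3) by (simp only: ennreal_plus ennreal_mult mult_nonneg_nonneg add_nonneg_nonneg powr_ge_zero zero_le_divide_1_iff zero_le_numeral)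
  with le have "x \<le> N powr m * y + 1 / 2 * (y + x)"
    unfolding xy using xy(1,3) by (simp only: ennreal_le_iff add_nonneg_nonneg mult_nonneg_nonneg powr_ge_zero zero_le_divide_1_iff zero_le_numeral)
  moreover have "(2 * N powr m + 1) * y = 2 * (N powr m * y) + y"
    by (simp add: algebra_simps)
  moreover have "x \<le> 2 * z + y" if "x \<le> z + 1 / 2 * (y + x)" for z :: real
    using that by (simp add: field_simps)
  ultimately have "x \<le> (2 * N powr m + 1) * y"
    by metis
  then have "A \<le> ennreal (2 * N powr m + 1) * \<mu>1"
    using xy by (simp add: ennreal_mult[symmetric] ennreal_leI del: ennreal_plus)
  then show ?thesis
    unfolding A_def \<mu>1_def N_m c_def q_def .
qed

section \<open>Finite measures dominated by the capacity\<close>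

lemma cap_mono: "E \<subseteq> F \<Longrightarrow> cap \<alpha> p E \<le> cap \<alpha> p F"
  unfolding cap_def by (rule INF_superset_mono) auto

text \<open>Finiteness is built in so that inner regularity and absorption apply; locally finite
  measures enter through their restrictions to balls, with the same \<open>C\<close>.\<close>

definition cap_dominated :: "real \<Rightarrow> real \<Rightarrow> real \<Rightarrow> 'a::euclidean_space measure \<Rightarrow> bool" where
  "cap_dominated \<alpha> p C \<mu> \<longleftrightarrow> sets \<mu> = sets borel \<and> emeasure \<mu> UNIV < top \<and>
     (\<forall>E. compact E \<longrightarrow> emeasure \<mu> E \<le> ennreal C * cap \<alpha> p E)"

lemma cap_dominatedD:
  assumes "cap_dominated \<alpha> p C \<mu>"
  shows "sets \<mu> = sets borel" "emeasure \<mu> UNIV < top" "space \<mu> = UNIV"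
    and "compact E \<Longrightarrow> emeasure \<mu> E \<le> ennreal C * cap \<alpha> p E"
  using assms sets_eq_imp_space_eq[of \<mu> borel] by (auto simp: cap_dominated_def)

lemma cap_dominated_restrict:
  fixes \<mu> :: "'a::euclidean_space measure"
  assumes [simp]: "sets \<mu> = sets borel" and B: "B \<in> sets borel" "emeasure \<mu> B < top"
    and cap: "\<And>E. compact E \<Longrightarrow> emeasure \<mu> E \<le> ennreal C * cap \<alpha> p E"
  shows "cap_dominated \<alpha> p C (density \<mu> (indicator B))"
  unfolding cap_dominated_def
proof (intro conjI allI impI)
  fix E :: "'a set" assume "compact E"
  then have "E \<in> sets borel"
    by (simp add: borel_compact)
  then have "emeasure (density \<mu> (indicator B)) E \<le> emeasure \<mu> E"
    using B by (subst emeasure_restricted) (auto intro: emeasure_mono)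
  also have "\<dots> \<le> ennreal C * cap \<alpha> p E"
    by (rule cap) fact
  finally show "emeasure (density \<mu> (indicator B)) E \<le> ennreal C * cap \<alpha> p E" .
qed (use B in \<open>simp_all add: emeasure_restricted\<close>)

text \<open>Finite Borel measures on a Euclidean space are inner regular, and \<open>cap\<close> is
  monotone. This passes from compact sets to the superlevel sets of potentials, which are known to
  be Borel.\<close>

lemma cap_dominated_borel:
  assumes "cap_dominated \<alpha> p C \<mu>" "F \<in> sets borel"
  shows "emeasure \<mu> F \<le> ennreal C * cap \<alpha> p F"
proof -
  note \<mu> = cap_dominatedD[OF assms(1)]
  have "emeasure \<mu> F = (SUP K \<in> {K. K \<subseteq> F \<and> compact K}. emeasure \<mu> K)"
    using \<mu>(2,3) by (intro inner_regular \<mu>(1) assms(2)) auto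
  also have "\<dots> \<le> ennreal C * cap \<alpha> p F"
  proof (rule SUP_least, safe)
    fix K assume "K \<subseteq> F" "compact K"
    then have "emeasure \<mu> K \<le> ennreal C * cap \<alpha> p K"
      by (intro \<mu>)
    also have "\<dots> \<le> ennreal C * cap \<alpha> p F"
      by (intro mult_left_mono cap_mono \<open>K \<subseteq> F\<close>) simp
    finally show "emeasure \<mu> K \<le> ennreal C * cap \<alpha> p F" .
  qed
  finally show ?thesis .
qed

lemma nn_integral_wolff_tail_power_finite:
  assumes [simp]: "sets \<mu> = sets borel" and "emeasure \<mu> UNIV < top" "0 \<le> a" "0 < b" "0 < d" "0 \<le> m"
  shows "(\<integral>\<^sup>+ x. epowr (wolff_tail a b d \<mu> x) m \<partial>\<mu>) < top"
proof -
  let ?M = "epowr (emeasure \<mu> UNIV) a * ennreal (d powr (- b) / b)"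
  have "?M < top"
    using epowr_less_top[OF assms(2), of a] by (simp add: ennreal_mult_less_top)
  have "(\<integral>\<^sup>+ x. epowr (wolff_tail a b d \<mu> x) m \<partial>\<mu>) \<le> (\<integral>\<^sup>+ x. epowr ?M m \<partial>\<mu>)"
    using assms by (intro nn_integral_mono epowr_mono wolff_tail_le) auto
  also have "\<dots> < top"
    using epowr_less_top[OF \<open>?M < top\<close>, of m] assms(2) sets_eq_imp_space_eq[OF assms(1)] by (simp add: ennreal_mult_less_top)
  finally show ?thesis .
qed

text \<open>A single \<open>c\<close> serves all measures and all \<open>d\<close>, so it survives
  both restriction to balls and the limit of \<open>d\<close> to zero. The type argument fixes the
  space.\<close>

definition wolff_energy_bound :: "'a::euclidean_space itself \<Rightarrow> real \<Rightarrow> real \<Rightarrow> real \<Rightarrow> real \<Rightarrow> real \<Rightarrow> bool" where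
  "wolff_energy_bound _ \<alpha> p C s c \<longleftrightarrow> 0 \<le> c \<and>
     (\<forall>(\<mu> :: 'a measure) d. cap_dominated \<alpha> p C \<mu> \<longrightarrow> 0 < d \<longrightarrow>
      (\<integral>\<^sup>+ x. epowr (wolff_tail (1 / (p - 1)) ((real DIM('a) - \<alpha> * p) / (p - 1)) d \<mu> x) s \<partial>\<mu>) \<le> ennreal c * emeasure \<mu> UNIV)"

text \<open>Start of the induction: the capacity bound, applied to \<mu> itself, gives decay of
  order \<open>p = 1 + (p - 1)\<close> for the superlevel sets, with the energy in the constant.
  Absorption then applies with \<open>m = 1\<close> and \<open>h = p - 1\<close>.\<close>

lemma wolff_energy_bound_1:
  fixes C \<alpha> p :: real
  assumes "1 < p" "0 < \<alpha>" "\<alpha> < real DIM('a::euclidean_space) / p" "0 \<le> C"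
  shows "\<exists>c. wolff_energy_bound TYPE('a) \<alpha> p C 1 c"
proof -
  define a b where "a = 1 / (p - 1)" and "b = (real DIM('a) - \<alpha> * p) / (p - 1)"
  have "0 < a" "0 < b"
    using assms by (simp_all add: a_def b_def field_simps)
  obtain K where K: "0 \<le> K" "\<And>(\<nu> :: 'a measure) d l E. sets \<nu> = sets borel \<Longrightarrow> emeasure \<nu> UNIV < top \<Longrightarrow> 0 < d \<Longrightarrow> 0 < l \<Longrightarrow>
     (\<forall>x\<in>E. ennreal l \<le> wolff_tail a b d \<nu> x) \<Longrightarrow>
     cap \<alpha> p E \<le> ennreal (K * l powr (- p)) * (\<integral>\<^sup>+ z. wolff_tail a b d \<nu> z \<partial>\<nu>)"
    using cap_wolff_superlevel[OF assms(1,2,3)] unfolding a_def b_def by metis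
  define c where "c = 2 * (2 * (2 powr 1 * (C * K) / (1 - 2 powr (- (p - 1)))) + 1) powr (1 / (p - 1)) + 1"
  have "(\<integral>\<^sup>+ x. epowr (wolff_tail a b d \<mu> x) 1 \<partial>\<mu>) \<le> ennreal c * emeasure \<mu> UNIV"
    if "cap_dominated \<alpha> p C \<mu>" "0 < d" for \<mu> :: "'a measure" and d
  proof -
    note \<mu> = cap_dominatedD[OF that(1)]
    note [simp, measurable_cong] = \<mu>(1)
    have [measurable]: "wolff_tail a b d \<mu> \<in> borel_measurable \<mu>"
      by measurable
    let ?A = "\<integral>\<^sup>+ x. epowr (wolff_tail a b d \<mu> x) 1 \<partial>\<mu>"
    show ?thesis
      unfolding c_def \<mu>(3)[symmetric]
    proof (rule nn_integral_power_absorb)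
      show "?A < top"
        using \<mu> \<open>0 < a\<close> \<open>0 < b\<close> \<open>0 < d\<close> by (intro nn_integral_wolff_tail_power_finite) auto
      fix l :: real assume "0 < l"
      have [measurable]: "{x. ennreal l < wolff_tail a b d \<mu> x} \<in> sets borel"
        by measurable
      have "emeasure \<mu> {x. ennreal l < wolff_tail a b d \<mu> x} \<le> ennreal C * cap \<alpha> p {x. ennreal l < wolff_tail a b d \<mu> x}"
        by (rule cap_dominated_borel[OF that(1)]) measurable
      also have "cap \<alpha> p {x. ennreal l < wolff_tail a b d \<mu> x} \<le> ennreal (K * l powr (- p)) * (\<integral>\<^sup>+ z. wolff_tail a b d \<mu> z \<partial>\<mu>)"
        using \<mu> \<open>0 < d\<close> \<open>0 < l\<close> by (intro K) auto
      also have "ennreal C * (ennreal (K * l powr (- p)) * (\<integral>\<^sup>+ z. wolff_tail a b d \<mu> z \<partial>\<mu>)) = ennreal (C * K * l powr (- p)) * ?A"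
        using \<open>0 \<le> C\<close> \<open>0 \<le> K\<close> by (simp add: ennreal_mult mult_ac)
      also have "\<dots> \<le> ennreal (C * K * l powr (- (1 + (p - 1)))) * (emeasure \<mu> (space \<mu>) + ?A)"
        by (intro mult_mono) auto
      finally show "emeasure \<mu> {x \<in> space \<mu>. ennreal l < wolff_tail a b d \<mu> x} \<le> ennreal (C * K * l powr (- (1 + (p - 1)))) * (emeasure \<mu> (space \<mu>) + ?A)"
        by (simp add: \<mu>(3) mult_left_mono)
    qed (use \<open>0 \<le> C\<close> \<open>0 \<le> K\<close> \<open>1 < p\<close> \<mu> in auto)
  qed
  moreover have "0 \<le> c" by (simp add: c_def)
  ultimately show ?thesis
    unfolding wolff_energy_bound_def a_def b_def by blast
qed

text \<open>The estimate for \<open>s\<close> controls the measure \<nu> whose density is the power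
  \<open>s\<close> of the potential \<rho>: it is finite, and both bounds for its potential are
  available. The set where \<rho> exceeds \<open>l\<close> lies where the potential of \<nu> is at
  least \<open>L * l powr (s * a + 1)\<close>, so the capacity bound improves the decay.\<close>

lemma wolff_energy_bound_step:
  fixes C \<alpha> p s c :: real
  assumes "1 < p" "0 < \<alpha>" "\<alpha> < real DIM('a::euclidean_space) / p" "0 \<le> C" "0 < s"
    and P: "wolff_energy_bound TYPE('a) \<alpha> p C s c"
  shows "\<exists>c'. wolff_energy_bound TYPE('a) \<alpha> p C (s + s / (p - 1) + 1) c'"
proof -
  define a b where "a = 1 / (p - 1)" and "b = (real DIM('a) - \<alpha> * p) / (p - 1)"
  have "0 < a" "0 < b"
    using assms by (simp_all add: a_def b_def field_simps)
  have "0 \<le> c" using P by (simp add: wolff_energy_bound_def)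
  have P: "(\<integral>\<^sup>+ x. epowr (wolff_tail a b d \<mu> x) s \<partial>\<mu>) \<le> ennreal c * emeasure \<mu> UNIV"
    if "cap_dominated \<alpha> p C \<mu>" "0 < d" for \<mu> :: "'a measure" and d
    using P that unfolding wolff_energy_bound_def a_def b_def by blast
  obtain K where K: "0 \<le> K" "\<And>(\<nu> :: 'a measure) d l E. sets \<nu> = sets borel \<Longrightarrow> emeasure \<nu> UNIV < top \<Longrightarrow> 0 < d \<Longrightarrow> 0 < l \<Longrightarrow>
     (\<forall>x\<in>E. ennreal l \<le> wolff_tail a b d \<nu> x) \<Longrightarrow>
     cap \<alpha> p E \<le> ennreal (K * l powr (- p)) * (\<integral>\<^sup>+ z. wolff_tail a b d \<nu> z \<partial>\<nu>)"
    using cap_wolff_superlevel[OF assms(1,2,3)] unfolding a_def b_def by metis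
  define m where "m = s + s * a + 1"
  have "0 < m"
    using \<open>0 < s\<close> \<open>0 < a\<close> by (simp add: m_def add_pos_pos)
  \<comment> \<open>The decay exponent from the capacity bound exceeds \<open>m\<close> by
    \<open>p - 1\<close>, the room needed for absorption.\<close>
  have mp: "(s * a + 1) * p = m + (p - 1)"
    using \<open>1 < p\<close> by (simp add: m_def a_def field_simps)
  define L where "L = (2::real) powr (- b * s * a - s * a - 1)"
  have "0 < L" by (simp add: L_def)
  define U where "U = 2 powr (s * a + a) * (c powr a * 2 powr b + 2 powr (b * s * a))"
  have "0 \<le> U" by (simp add: U_def)
  define K' where "K' = C * K * L powr (- p) * (2 * U)"
  have "0 \<le> K'" using \<open>0 \<le> C\<close> \<open>0 \<le> K\<close> \<open>0 \<le> U\<close> by (simp add: K'_def)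
  define c' where "c' = 2 * (2 * (2 powr m * K' / (1 - 2 powr (- (p - 1)))) + 1) powr (m / (p - 1)) + 1"
  have "(\<integral>\<^sup>+ x. epowr (wolff_tail a b d \<mu> x) m \<partial>\<mu>) \<le> ennreal c' * emeasure \<mu> UNIV"
    if dom: "cap_dominated \<alpha> p C \<mu>" and "0 < d" for \<mu> :: "'a measure" and d
  proof -
    note \<mu> = cap_dominatedD[OF dom]
    note [simp, measurable_cong] = \<mu>(1)
    define \<rho> where "\<rho> = wolff_tail a b d \<mu>"
    have [measurable]: "\<rho> \<in> borel_measurable borel"
      unfolding \<rho>_def by measurable
    let ?A = "\<integral>\<^sup>+ x. epowr (\<rho> x) m \<partial>\<mu>"
    define \<nu> where "\<nu> = density \<mu> (\<lambda>y. epowr (\<rho> y) s)"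
    have sets_\<nu> [simp]: "sets \<nu> = sets borel"
      by (simp add: \<nu>_def)
    have [measurable]: "wolff_tail a b d \<nu> \<in> borel_measurable borel"
      by measurable
    have "emeasure \<nu> UNIV = (\<integral>\<^sup>+ x. epowr (\<rho> x) s \<partial>\<mu>)"
      by (simp add: \<nu>_def emeasure_density)
    also have "\<dots> \<le> ennreal c * emeasure \<mu> UNIV"
      unfolding \<rho>_def using that by (rule P)
    also have "\<dots> < top"
      using \<mu>(2) by (simp add: ennreal_mult_less_top)
    finally have fin_\<nu>: "emeasure \<nu> UNIV < top" .
    have upper: "wolff_tail a b d \<nu> x \<le> ennreal U * (\<rho> x + epowr (\<rho> x) (s * a + 1))" for x
      unfolding \<nu>_def \<rho>_def U_def
    proof (rule wolff_tail_power_upper)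
      fix z :: 'a and r :: real
      \<comment> \<open>The energy estimate for \<open>s\<close> is applied to the restriction of
        \<mu>, which stays in the class with the same \<open>C\<close>.\<close>
      have dom': "cap_dominated \<alpha> p C (density \<mu> (indicator (ball z r)))"
        using \<mu> emeasure_mono[of "ball z r" UNIV \<mu>] by (intro cap_dominated_restrict) (auto elim: le_less_trans)
      have "sets (density \<mu> (indicator (ball z r))) = sets borel"
        by simp
      note [measurable] = borel_measurable_wolff_tail[OF this]
      from P[OF dom' \<open>0 < d\<close>]
      show "(\<integral>\<^sup>+ y\<in>ball z r. epowr (wolff_tail a b d (density \<mu> (indicator (ball z r))) y) s \<partial>\<mu>) \<le> ennreal c * emeasure \<mu> (ball z r)"
        by (simp add: nn_integral_density emeasure_restricted mult.commute)
    qed (use \<mu> \<open>0 < a\<close> \<open>0 < s\<close> \<open>0 < d\<close> \<open>0 \<le> c\<close> in auto)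
    have energy: "(\<integral>\<^sup>+ z. wolff_tail a b d \<nu> z \<partial>\<nu>) \<le> ennreal (2 * U) * (emeasure \<mu> UNIV + ?A)"
    proof -
      have "(\<integral>\<^sup>+ z. wolff_tail a b d \<nu> z \<partial>\<nu>) = (\<integral>\<^sup>+ z. epowr (\<rho> z) s * wolff_tail a b d \<nu> z \<partial>\<mu>)"
        by (subst \<nu>_def) (simp add: nn_integral_density)
      also have "\<dots> \<le> (\<integral>\<^sup>+ z. ennreal (2 * U) * (1 + epowr (\<rho> z) m) \<partial>\<mu>)"
      proof (rule nn_integral_mono)
        fix z
        have "epowr (\<rho> z) s * wolff_tail a b d \<nu> z \<le> epowr (\<rho> z) s * (ennreal U * (\<rho> z + epowr (\<rho> z) (s * a + 1)))"
          using upper by (rule mult_left_mono) simp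
        also have "\<dots> = ennreal U * (epowr (\<rho> z) (s + 1) + epowr (\<rho> z) m)"
          using epowr_add_exp[of "\<rho> z" s 1] epowr_add_exp[of "\<rho> z" s "s * a + 1"]
          by (simp add: m_def ring_distribs mult_ac add_ac)
        also have "\<dots> \<le> ennreal U * ((1 + epowr (\<rho> z) m) + (1 + epowr (\<rho> z) m))"
          using \<open>0 < s\<close> \<open>0 < a\<close>
          by (intro mult_left_mono add_mono epowr_le_add) (auto simp: m_def intro: add_increasing)
        also have "\<dots> = ennreal (2 * U) * (1 + epowr (\<rho> z) m)"
          using \<open>0 \<le> U\<close> by (simp add: ennreal_mult mult_2[symmetric] mult_ac)
        finally show "epowr (\<rho> z) s * wolff_tail a b d \<nu> z \<le> ennreal (2 * U) * (1 + epowr (\<rho> z) m)" .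
      qed
      also have "\<dots> = ennreal (2 * U) * (emeasure \<mu> UNIV + ?A)"
        by (simp add: nn_integral_cmult nn_integral_add \<mu>(3))
      finally show ?thesis .
    qed
    show ?thesis
      unfolding c'_def \<mu>(3)[symmetric] \<rho>_def[symmetric]
    proof (rule nn_integral_power_absorb)
      show "?A < top"
        unfolding \<rho>_def using \<mu> \<open>0 < a\<close> \<open>0 < b\<close> \<open>0 < d\<close> \<open>0 < m\<close> by (intro nn_integral_wolff_tail_power_finite) auto
      fix l :: real assume "0 < l"
      let ?F = "{x. ennreal l < \<rho> x}" and ?l = "L * l powr (s * a + 1)"
      have "emeasure \<mu> ?F \<le> ennreal C * cap \<alpha> p ?F"
        by (rule cap_dominated_borel[OF dom]) measurable
      also have "cap \<alpha> p ?F \<le> ennreal (K * ?l powr (- p)) * (\<integral>\<^sup>+ z. wolff_tail a b d \<nu> z \<partial>\<nu>)"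
      proof (rule K)
        show "\<forall>x\<in>?F. ennreal ?l \<le> wolff_tail a b d \<nu> x"
        proof safe
          fix x assume "ennreal l < \<rho> x"
          then have "ennreal L * epowr (ennreal l) (s * a + 1) \<le> ennreal L * epowr (\<rho> x) (s * a + 1)"
            using \<open>0 < s\<close> \<open>0 < a\<close> by (intro mult_left_mono epowr_mono) auto
          also have "\<dots> \<le> wolff_tail a b d \<nu> x"
            unfolding L_def \<rho>_def \<nu>_def using \<open>0 < s\<close> \<open>0 < a\<close> \<open>0 < d\<close> by (intro wolff_tail_power_lower) auto
          finally show "ennreal ?l \<le> wolff_tail a b d \<nu> x"
            using \<open>0 < l\<close> \<open>0 < L\<close> by (simp add: epowr_ennreal ennreal_mult)
        qed
      qed (use fin_\<nu> \<open>0 < d\<close> \<open>0 < l\<close> \<open>0 < L\<close> in auto)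
      also have "(\<integral>\<^sup>+ z. wolff_tail a b d \<nu> z \<partial>\<nu>) \<le> ennreal (2 * U) * (emeasure \<mu> UNIV + ?A)"
        by (rule energy)
      also have "ennreal C * (ennreal (K * ?l powr (- p)) * (ennreal (2 * U) * (emeasure \<mu> UNIV + ?A)))
        = ennreal (C * (K * ?l powr (- p)) * (2 * U)) * (emeasure \<mu> UNIV + ?A)"
      proof -
        have "ennreal C * (ennreal X * (ennreal V * z)) = ennreal (C * X * V) * z" if "0 \<le> X" "0 \<le> V" for X V z
          using that \<open>0 \<le> C\<close> by (simp add: ennreal_mult mult_ac)
        then show ?thesis
          using \<open>0 \<le> K\<close> \<open>0 \<le> U\<close> by simp
      qed
      also have "C * (K * ?l powr (- p)) * (2 * U) = K' * l powr (- (m + (p - 1)))"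
        unfolding mp[symmetric] using \<open>0 < L\<close> \<open>0 < l\<close> by (simp add: K'_def powr_mult powr_powr)
      finally show "emeasure \<mu> {x \<in> space \<mu>. ennreal l < \<rho> x} \<le> ennreal (K' * l powr (- (m + (p - 1)))) * (emeasure \<mu> (space \<mu>) + ?A)"
        by (simp add: \<mu>(3) mult_left_mono)
    qed (use \<open>0 \<le> K'\<close> \<open>1 < p\<close> \<open>0 < m\<close> \<mu> in auto)
  qed
  moreover have "0 \<le> c'" by (simp add: c'_def)
  moreover have "s + s / (p - 1) + 1 = m"
    by (simp add: m_def a_def)
  ultimately show ?thesis
    unfolding wolff_energy_bound_def a_def b_def by metis
qed

text \<open>Each step raises the exponent by at least one, so every \<open>s\<close> is exceeded;
  from there \<open>epowr_le_add\<close> and the finite mass lead back down to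
  \<open>s\<close>.\<close>

lemma wolff_energy_bound_exists:
  fixes C \<alpha> p s :: real
  assumes "1 < p" "0 < \<alpha>" "\<alpha> < real DIM('a::euclidean_space) / p" "0 \<le> C" "0 < s"
  shows "\<exists>c. wolff_energy_bound TYPE('a) \<alpha> p C s c"
proof -
  have "\<exists>s c. real k + 1 \<le> s \<and> wolff_energy_bound TYPE('a) \<alpha> p C s c" for k
  proof (induction k)
    case 0
    then show ?case
      using wolff_energy_bound_1[OF assms(1-4)] by force
  next
    case (Suc k)
    then obtain s c where s: "real k + 1 \<le> s" "wolff_energy_bound TYPE('a) \<alpha> p C s c"
      by blast
    then have "0 < s" by simp
    moreover have "0 \<le> s / (p - 1)"
      using \<open>0 < s\<close> \<open>1 < p\<close> by simp
    then have "real (Suc k) + 1 \<le> s + s / (p - 1) + 1"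
      using s(1) by simp
    ultimately show ?case
      using wolff_energy_bound_step[OF assms(1-4) _ s(2)] by blast
  qed
  then obtain m c where m: "real (nat \<lceil>s\<rceil>) + 1 \<le> m" and c: "wolff_energy_bound TYPE('a) \<alpha> p C m c"
    by blast
  have "s \<le> m"
    using m real_nat_ceiling_ge[of s] by linarith
  define a b where "a = 1 / (p - 1)" and "b = (real DIM('a) - \<alpha> * p) / (p - 1)"
  have "(\<integral>\<^sup>+ x. epowr (wolff_tail a b d \<mu> x) s \<partial>\<mu>) \<le> ennreal (1 + c) * emeasure \<mu> UNIV"
    if "cap_dominated \<alpha> p C \<mu>" "0 < d" for \<mu> :: "'a measure" and d
  proof -
    note \<mu> = cap_dominatedD[OF that(1)]
    note [simp, measurable_cong] = \<mu>(1)
    have "(\<integral>\<^sup>+ x. epowr (wolff_tail a b d \<mu> x) s \<partial>\<mu>) \<le> (\<integral>\<^sup>+ x. 1 + epowr (wolff_tail a b d \<mu> x) m \<partial>\<mu>)"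
      using \<open>0 < s\<close> \<open>s \<le> m\<close> by (intro nn_integral_mono epowr_le_add) auto
    also have "\<dots> = emeasure \<mu> UNIV + (\<integral>\<^sup>+ x. epowr (wolff_tail a b d \<mu> x) m \<partial>\<mu>)"
      by (simp add: nn_integral_add \<mu>(3))
    also have "\<dots> \<le> emeasure \<mu> UNIV + ennreal c * emeasure \<mu> UNIV"
      using c that unfolding wolff_energy_bound_def a_def b_def by (intro add_left_mono) blast
    also have "\<dots> = ennreal (1 + c) * emeasure \<mu> UNIV"
      using c by (simp add: wolff_energy_bound_def ring_distribs)
    finally show ?thesis .
  qed
  then have "wolff_energy_bound TYPE('a) \<alpha> p C s (1 + c)"
    using c unfolding wolff_energy_bound_def a_def b_def by auto
  then show ?thesis ..
qed

text \<open>Since \<open>c\<close> does not depend on the truncation, monotone convergence along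
  \<open>d = 1 / (k + 1)\<close> removes it.\<close>

lemma wolff_energy_bound_0:
  fixes \<mu> :: "'a::euclidean_space measure"
  assumes "wolff_energy_bound TYPE('a) \<alpha> p C s c" "cap_dominated \<alpha> p C \<mu>" "0 < s" "1 < p"
  shows "(\<integral>\<^sup>+ x. epowr (wolff \<alpha> p \<mu> x) s \<partial>\<mu>) \<le> ennreal c * emeasure \<mu> UNIV"
proof -
  define a b where "a = 1 / (p - 1)" and "b = (real DIM('a) - \<alpha> * p) / (p - 1)"
  note \<mu> = cap_dominatedD[OF assms(2)]
  note [simp, measurable_cong] = \<mu>(1)
  have "(\<integral>\<^sup>+ x. epowr (wolff \<alpha> p \<mu> x) s \<partial>\<mu>) = (\<integral>\<^sup>+ x. (SUP k. epowr (wolff_tail a b (1 / real (Suc k)) \<mu> x) s) \<partial>\<mu>)"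
    using \<open>1 < p\<close> \<open>0 < s\<close>
    by (simp add: wolff_eq_wolff_tail a_def[symmetric] b_def[symmetric] wolff_tail_0_eq_SUP epowr_SUP del: of_nat_Suc)
  also have "\<dots> = (SUP k. \<integral>\<^sup>+ x. epowr (wolff_tail a b (1 / real (Suc k)) \<mu> x) s \<partial>\<mu>)"
    using \<open>0 < s\<close>
    by (intro nn_integral_monotone_convergence_SUP incseq_SucI le_funI epowr_mono wolff_tail_antimono) (auto simp: frac_le)
  also have "\<dots> \<le> ennreal c * emeasure \<mu> UNIV"
    using assms(1,2) unfolding wolff_energy_bound_def a_def b_def by (intro SUP_least) auto
  finally show ?thesis .
qed

section \<open>Existence of solutions\<close>

lemma wolff_tail_density_cmult:
  assumes [simp, measurable_cong]: "sets \<sigma> = sets borel" and [measurable]: "f \<in> borel_measurable borel" and "0 < a"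
  shows "wolff_tail a b d (density \<sigma> (\<lambda>y. k * f y)) x = epowr k a * wolff_tail a b d (density \<sigma> f) x"
proof -
  have "emeasure (density \<sigma> (\<lambda>y. k * f y)) (ball x t) = k * emeasure (density \<sigma> f) (ball x t)" for t
    by (simp add: emeasure_density mult.assoc nn_integral_cmult)
  moreover have [measurable]: "(\<lambda>t. emeasure (density \<sigma> f) (ball x t)) \<in> borel_measurable borel"
    by (rule borel_measurable_emeasure_ball_comp) auto
  ultimately show ?thesis
    unfolding wolff_tail_def using \<open>0 < a\<close>
    by (simp add: epowr_mult mult.assoc nn_integral_cmult)
qed

lemma wolff_tail_density_add_le:
  assumes [simp, measurable_cong]: "sets \<sigma> = sets borel"
    and [measurable]: "f \<in> borel_measurable borel" "g \<in> borel_measurable borel" and "0 < a"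
  shows "wolff_tail a b d (density \<sigma> (\<lambda>y. f y + g y)) x
    \<le> ennreal (2 powr a) * (wolff_tail a b d (density \<sigma> f) x + wolff_tail a b d (density \<sigma> g) x)"
proof -
  let ?w = "\<lambda>f t. epowr (emeasure (density \<sigma> f) (ball x t)) a * ennreal (t powr (- b - 1)) * indicator {d<..} t"
  have [measurable]: "(\<lambda>t. emeasure (density \<sigma> f) (ball x t)) \<in> borel_measurable borel"
    "(\<lambda>t. emeasure (density \<sigma> g) (ball x t)) \<in> borel_measurable borel"
    by (rule borel_measurable_emeasure_ball_comp; simp)+
  have "wolff_tail a b d (density \<sigma> (\<lambda>y. f y + g y)) x \<le> (\<integral>\<^sup>+ t. ennreal (2 powr a) * (?w f t + ?w g t) \<partial>lborel)"
    unfolding wolff_tail_def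
  proof (rule nn_integral_mono)
    fix t
    have "emeasure (density \<sigma> (\<lambda>y. f y + g y)) (ball x t) = emeasure (density \<sigma> f) (ball x t) + emeasure (density \<sigma> g) (ball x t)"
      by (simp add: emeasure_density distrib_right nn_integral_add)
    then have "?w (\<lambda>y. f y + g y) t \<le> ennreal (2 powr a) *
        (epowr (emeasure (density \<sigma> f) (ball x t)) a + epowr (emeasure (density \<sigma> g) (ball x t)) a)
        * ennreal (t powr (- b - 1)) * indicator {d<..} t"
      using \<open>0 < a\<close> by (auto intro!: mult_right_mono epowr_plus_le)
    then show "?w (\<lambda>y. f y + g y) t \<le> ennreal (2 powr a) * (?w f t + ?w g t)"
      by (simp add: ring_distribs mult_ac)
  qed
  also have "\<dots> = ennreal (2 powr a) * (wolff_tail a b d (density \<sigma> f) x + wolff_tail a b d (density \<sigma> g) x)"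
    unfolding wolff_tail_def by (simp add: nn_integral_cmult nn_integral_add)
  finally show ?thesis .
qed

section \<open>Local integrability of powers of the potential\<close>

lemma emeasure_ball_finite:
  fixes \<sigma> :: "'a::euclidean_space measure"
  assumes "sets \<sigma> = sets borel" "\<And>K. compact K \<Longrightarrow> emeasure \<sigma> K < top"
  shows "emeasure \<sigma> (ball x r) < top"
proof -
  have "emeasure \<sigma> (ball x r) \<le> emeasure \<sigma> (cball x r)"
    using assms(1) by (intro emeasure_mono) auto
  then show ?thesis
    using assms(2)[OF compact_cball, of x r] by (rule le_less_trans)
qed

text \<open>Supplies the hypothesis \<open>local\<close> of \<open>wolff_tail_power_upper\<close>
  for a locally finite \<sigma> at truncation zero.\<close>

lemma nn_integral_wolff_restrict_le:
  fixes \<sigma> :: "'a::euclidean_space measure"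
  assumes [simp, measurable_cong]: "sets \<sigma> = sets borel" and "\<And>K. compact K \<Longrightarrow> emeasure \<sigma> K < top"
    and "\<And>E. compact E \<Longrightarrow> emeasure \<sigma> E \<le> ennreal C * cap \<alpha> p E"
    and "wolff_energy_bound TYPE('a) \<alpha> p C s c" "0 < s" "1 < p"
  shows "(\<integral>\<^sup>+ y\<in>ball x r. epowr (wolff \<alpha> p (density \<sigma> (indicator (ball x r))) y) s \<partial>\<sigma>) \<le> ennreal c * emeasure \<sigma> (ball x r)"
proof -
  let ?\<mu> = "density \<sigma> (indicator (ball x r))"
  have "sets ?\<mu> = sets borel" by simp
  note [measurable] = borel_measurable_wolff_tail[OF this]
  have "cap_dominated \<alpha> p C ?\<mu>"
    using assms by (intro cap_dominated_restrict emeasure_ball_finite) auto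
  from wolff_energy_bound_0[OF assms(4) this \<open>0 < s\<close> \<open>1 < p\<close>] show ?thesis
    using \<open>1 < p\<close> by (simp add: nn_integral_density emeasure_restricted mult.commute wolff_eq_wolff_tail)
qed

text \<open>With \<open>K\<close> inside \<open>ball 0 R\<close>, the part of \<sigma> in the
  doubled ball is covered by the energy estimate, and radii above \<open>R\<close> contribute at
  most a multiple of the tail at the origin, finite by \<open>tail\<close>.\<close>

lemma nn_integral_wolff_power_finite:
  fixes \<sigma> :: "'a::euclidean_space measure"
  assumes [simp, measurable_cong]: "sets \<sigma> = sets borel" and fin: "\<And>K. compact K \<Longrightarrow> emeasure \<sigma> K < top"
    and "\<And>E. compact E \<Longrightarrow> emeasure \<sigma> E \<le> ennreal C * cap \<alpha> p E"
    and "1 < p" "0 < \<alpha>" "\<alpha> < real DIM('a) / p" "0 \<le> C" "0 < s"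
    and tail: "(\<integral>\<^sup>+ t\<in>{1..}. epowr (emeasure \<sigma> (ball 0 t) / ennreal (t powr (real DIM('a) - \<alpha> * p)))
                          (1 / (p - 1)) * ennreal (1 / t) \<partial>lborel) < top"
    and "compact K"
  shows "(\<integral>\<^sup>+ x\<in>K. epowr (wolff \<alpha> p \<sigma> x) s \<partial>\<sigma>) < top"
proof -
  define a b where "a = 1 / (p - 1)" and "b = (real DIM('a) - \<alpha> * p) / (p - 1)"
  have W: "wolff \<alpha> p \<mu> x = wolff_tail a b 0 \<mu> x" for \<mu> :: "'a measure" and x
    unfolding a_def b_def using \<open>1 < p\<close> by (rule wolff_eq_wolff_tail)
  obtain c where c: "wolff_energy_bound TYPE('a) \<alpha> p C s c"
    using wolff_energy_bound_exists[OF assms(4-8)] by blast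
  \<comment> \<open>\<open>R\<close> exceeds the norms of the points of \<open>K\<close>, as the
    shift to the origin requires, and is at least one, so that the tail at \<open>R\<close> is at
    most the tail at one.\<close>
  obtain R where R: "1 \<le> R" "K \<subseteq> ball 0 R"
  proof -
    obtain r where r: "\<And>x. x \<in> K \<Longrightarrow> norm x \<le> r"
      using compact_imp_bounded[OF \<open>compact K\<close>] by (auto simp: bounded_iff)
    have "K \<subseteq> ball 0 (max 1 (r + 1))"
      using r by (force simp: less_max_iff_disj)
    then show thesis
      by (intro that[of "max 1 (r + 1)"]) auto
  qed
  let ?B = "ball 0 (2 * R) :: 'a set"
  let ?\<mu> = "density \<sigma> (indicator ?B)"
  have "sets ?\<mu> = sets borel" by simp
  note [measurable] = borel_measurable_wolff_tail[OF this]
  have [measurable]: "K \<in> sets borel"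
    using \<open>compact K\<close> by (rule borel_compact)
  let ?M = "ennreal (2 powr b) * wolff_tail a b 1 \<sigma> 0"
  have "wolff_tail a b 1 \<sigma> 0 \<le> (\<integral>\<^sup>+ t\<in>{1..}. epowr (emeasure \<sigma> (ball 0 t) / ennreal (t powr (real DIM('a) - \<alpha> * p)))
                          (1 / (p - 1)) * ennreal (1 / t) \<partial>lborel)"
    unfolding wolff_tail_def a_def b_def
    by (intro nn_integral_mono) (auto split: split_indicator simp: wolff_integrand_eq[OF \<open>1 < p\<close>])
  with tail have M: "?M < top"
    by (simp add: ennreal_mult_less_top le_less_trans)
  have "(\<integral>\<^sup>+ x\<in>K. epowr (wolff \<alpha> p \<sigma> x) s \<partial>\<sigma>)
    \<le> (\<integral>\<^sup>+ x. ennreal (2 powr s) * (epowr (wolff \<alpha> p ?\<mu> x) s * indicator ?B x + epowr ?M s * indicator K x) \<partial>\<sigma>)"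
  proof (rule nn_integral_mono)
    fix y :: 'a
    show "epowr (wolff \<alpha> p \<sigma> y) s * indicator K y
      \<le> ennreal (2 powr s) * (epowr (wolff \<alpha> p ?\<mu> y) s * indicator ?B y + epowr ?M s * indicator K y)"
    proof (cases "y \<in> K")
      case True
      then have y: "norm y < R" using R by auto
      have "ball y R \<subseteq> ?B"
      proof
        fix z assume "z \<in> ball y R"
        then show "z \<in> ?B"
          using dist_triangle[of 0 z y] y by simp
      qed
      then have "wolff_tail a b 0 \<sigma> y \<le> wolff_tail a b 0 ?\<mu> y + wolff_tail a b R \<sigma> y"
        using R \<open>1 < p\<close> by (intro wolff_tail_split) (auto simp: a_def)
      also have "wolff_tail a b R \<sigma> y \<le> ennreal (2 powr b) * wolff_tail a b R \<sigma> 0"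
        using y \<open>1 < p\<close> by (intro wolff_tail_shift) (auto simp: a_def)
      also have "\<dots> \<le> ?M"
        using R by (intro mult_left_mono wolff_tail_antimono) auto
      finally have "wolff \<alpha> p \<sigma> y \<le> wolff \<alpha> p ?\<mu> y + ?M"
        by (simp add: W add_left_mono)
      then have "epowr (wolff \<alpha> p \<sigma> y) s \<le> epowr (wolff \<alpha> p ?\<mu> y + ?M) s"
        using \<open>0 < s\<close> by (intro epowr_mono) auto
      also have "\<dots> \<le> ennreal (2 powr s) * (epowr (wolff \<alpha> p ?\<mu> y) s + epowr ?M s)"
        using \<open>0 < s\<close> by (rule epowr_plus_le)
      finally show ?thesis
        using True y R by simp
    qed simp
  qed
  also have "\<dots> = ennreal (2 powr s) * ((\<integral>\<^sup>+ x\<in>?B. epowr (wolff \<alpha> p ?\<mu> x) s \<partial>\<sigma>) + epowr ?M s * emeasure \<sigma> K)"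
    unfolding W by (simp add: nn_integral_cmult nn_integral_add)
  also have "\<dots> < top"
  proof -
    have "(\<integral>\<^sup>+ x\<in>?B. epowr (wolff \<alpha> p ?\<mu> x) s \<partial>\<sigma>) \<le> ennreal c * emeasure \<sigma> ?B"
      using assms c by (intro nn_integral_wolff_restrict_le) auto
    also have "\<dots> < top"
      using emeasure_ball_finite[of \<sigma> 0 "2 * R"] fin by (simp add: ennreal_mult_less_top)
    finally show ?thesis
      using fin[OF \<open>compact K\<close>] epowr_less_top[OF M, of s] by (simp add: ennreal_mult_less_top)
  qed
  finally show ?thesis .
qed

text \<open>This is \<open>epowr_le_add\<close> for the exponents \<open>t - 1\<close> and
  \<open>m - 1\<close>, multiplied by \<open>x\<close>. It replaces an intermediate power by the two
  powers in the supersolution.\<close>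

lemma epowr_interpolate:
  assumes "1 \<le> t" "t \<le> m"
  shows "epowr x t \<le> x + epowr x m"
proof -
  have "epowr x (t - 1) * epowr x 1 \<le> (1 + epowr x (m - 1)) * epowr x 1"
    using assms by (intro mult_right_mono epowr_le_add) auto
  then show ?thesis
    by (simp add: distrib_right epowr_add_exp[symmetric, of x _ 1, simplified epowr_one_exp])
qed

text \<open>The iterates of the monotone operator \<open>T\<close> increase from the subsolution and
  stay below the supersolution. Their supremum is a fixed point by monotone convergence, first in
  the measures of balls and then in the potential. The equation holds at every point, with infinite
  values allowed.\<close>

lemma wolff_fixed_point:
  fixes \<sigma> :: "'a::euclidean_space measure"
  assumes [simp, measurable_cong]: "sets \<sigma> = sets borel" and "1 < p" "0 < q"
    and [measurable]: "u0 \<in> borel_measurable borel" "v \<in> borel_measurable borel"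
    and sub: "\<And>x. u0 x \<le> wolff \<alpha> p (density \<sigma> (\<lambda>y. epowr (u0 y) q)) x"
    and super: "\<And>x. wolff \<alpha> p (density \<sigma> (\<lambda>y. epowr (v y) q)) x \<le> v x"
    and le: "\<And>x. u0 x \<le> v x"
  shows "\<exists>u. u \<in> borel_measurable borel \<and> (\<forall>x. u x = wolff \<alpha> p (density \<sigma> (\<lambda>y. epowr (u y) q)) x)
    \<and> (\<forall>x. u0 x \<le> u x) \<and> (\<forall>x. u x \<le> v x)"
proof -
  define T where "T u = wolff \<alpha> p (density \<sigma> (\<lambda>y. epowr (u y) q))" for u
  have T_eq: "T u = wolff_tail (1 / (p - 1)) ((real DIM('a) - \<alpha> * p) / (p - 1)) 0 (density \<sigma> (\<lambda>y. epowr (u y) q))" for u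
    unfolding T_def using \<open>1 < p\<close> by (intro ext wolff_eq_wolff_tail)
  have T_meas: "T u \<in> borel_measurable borel" for u
    unfolding T_eq by (rule borel_measurable_wolff_tail) simp
  have mono_em: "emeasure (density \<sigma> (\<lambda>y. epowr (f y) q)) B \<le> emeasure (density \<sigma> (\<lambda>y. epowr (g y) q)) B"
    if [measurable]: "f \<in> borel_measurable borel" "g \<in> borel_measurable borel" "B \<in> sets borel" and "\<And>x. f x \<le> g x" for f g B
    using that(4) \<open>0 < q\<close>
    by (simp add: emeasure_density) (intro nn_integral_mono mult_right_mono epowr_mono; simp)
  have T_mono: "T f x \<le> T g x"
    if "f \<in> borel_measurable borel" "g \<in> borel_measurable borel" "\<And>x. f x \<le> g x" for f g x
    unfolding T_eq using that \<open>1 < p\<close> by (intro wolff_tail_mono mono_em) auto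
  define w where "w k = (T ^^ k) u0" for k
  have w_Suc: "w (Suc k) = T (w k)" for k
    by (simp add: w_def)
  have w_meas [measurable]: "w k \<in> borel_measurable borel" for k
    by (cases k) (simp_all add: w_def T_meas)
  have w_mono: "w k x \<le> w (Suc k) x" for k x
  proof (induction k arbitrary: x)
    case 0
    show ?case using sub by (simp add: w_def T_def)
  next
    case (Suc k)
    then have "T (w k) x \<le> T (w (Suc k)) x"
      by (intro T_mono w_meas)
    then show ?case
      by (simp only: w_Suc)
  qed
  then have w_inc: "incseq (\<lambda>k. w k x)" for x
    by (rule incseq_SucI)
  have w_le: "w k x \<le> v x" for k x
  proof (induction k arbitrary: x)
    case 0
    show ?case using le by (simp add: w_def)
  next
    case (Suc k)
    have "w (Suc k) x \<le> T v x"
      unfolding w_Suc by (intro T_mono Suc) auto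
    also have "\<dots> \<le> v x"
      unfolding T_def by (rule super)
    finally show ?case .
  qed
  define u where "u x = (SUP k. w k x)" for x
  have [measurable]: "u \<in> borel_measurable borel"
    unfolding u_def[abs_def] by measurable
  have "T u x = (SUP k. T (w k) x)" for x
    unfolding T_eq
  proof (rule wolff_tail_SUP)
    fix t
    show "incseq (\<lambda>k. emeasure (density \<sigma> (\<lambda>y. epowr (w k y) q)) (ball x t))"
      using w_mono by (intro incseq_SucI mono_em) auto
    have "emeasure (density \<sigma> (\<lambda>y. epowr (u y) q)) (ball x t) = (\<integral>\<^sup>+ y. (SUP k. epowr (w k y) q * indicator (ball x t) y) \<partial>\<sigma>)"
      using \<open>0 < q\<close> by (simp add: emeasure_density u_def epowr_SUP SUP_mult_right_ennreal)
    also have "\<dots> = (SUP k. \<integral>\<^sup>+ y\<in>ball x t. epowr (w k y) q \<partial>\<sigma>)"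
      using w_mono \<open>0 < q\<close>
      by (intro nn_integral_monotone_convergence_SUP incseq_SucI le_funI mult_right_mono epowr_mono) auto
    finally show "emeasure (density \<sigma> (\<lambda>y. epowr (u y) q)) (ball x t) = (SUP k. emeasure (density \<sigma> (\<lambda>y. epowr (w k y) q)) (ball x t))"
      by (simp add: emeasure_density)
  qed (use \<open>1 < p\<close> in auto)
  then have "T u x = (SUP k. w (Suc k) x)" for x
    by (simp add: w_Suc)
  also have "(SUP k. w (Suc k) x) = u x" for x
    unfolding u_def
  proof (rule antisym)
    show "(SUP k. w k x) \<le> (SUP k. w (Suc k) x)"
      using w_mono by (rule SUP_mono')
    show "(SUP k. w (Suc k) x) \<le> (SUP k. w k x)"
      by (rule SUP_least) (rule SUP_upper, simp)
  qed
  finally have "u x = T u x" for x by simp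
  moreover have "u0 x \<le> u x" for x
    using SUP_upper[of 0 UNIV "\<lambda>k. w k x"] by (simp add: u_def w_def)
  moreover have "u x \<le> v x" for x
    unfolding u_def by (intro SUP_least w_le)
  ultimately show ?thesis
    unfolding T_def using \<open>u \<in> borel_measurable borel\<close> by blast
qed

theorem theorem3p2:
  fixes p q \<alpha> C :: real
  assumes "1 < p" and "0 < q" and "q < p - 1" and "0 < \<alpha>" and "\<alpha> < real DIM('a::euclidean_space) / p"
  shows "\<exists>c>0. \<forall>\<sigma> :: 'a measure.
     sets \<sigma> = sets borel \<longrightarrow>
     (\<forall>K. compact K \<longrightarrow> emeasure \<sigma> K < \<infinity>) \<longrightarrow>
     (\<forall>E. compact E \<longrightarrow> emeasure \<sigma> E \<le> ennreal C * cap \<alpha> p E) \<longrightarrow>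
     (\<integral>\<^sup>+ t\<in>{1..}. epowr (emeasure \<sigma> (ball 0 t) / ennreal (t powr (real DIM('a) - \<alpha> * p)))
                          (1 / (p - 1)) * ennreal (1 / t) \<partial>lborel) < \<infinity> \<longrightarrow>
     (\<exists>u :: 'a \<Rightarrow> ennreal.
        Lloc q \<sigma> u \<and>
        (\<forall>x. u x = wolff \<alpha> p (density \<sigma> (\<lambda>y. epowr (u y) q)) x) \<and>
        (\<forall>x. ennreal (1 / c) * epowr (wolff \<alpha> p \<sigma> x) ((p - 1) / (p - 1 - q)) \<le> u x) \<and>
        (\<forall>x. u x \<le> ennreal c * (wolff \<alpha> p \<sigma> x + epowr (wolff \<alpha> p \<sigma> x) ((p - 1) / (p - 1 - q)))) \<and>
        (\<forall>s>0. Lloc s \<sigma> u))"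
proof -
  define a b g where "a = 1 / (p - 1)" and "b = (real DIM('a) - \<alpha> * p) / (p - 1)" and "g = (p - 1) / (p - 1 - q)"
  have "0 < a" "0 < b"
    using assms by (simp_all add: a_def b_def field_simps)
  have "q * a < 1"
    using assms by (simp add: a_def field_simps)
  have "1 \<le> g"
    using assms by (simp add: g_def field_simps)
  \<comment> \<open>In both pointwise bounds the density \<open>epowr (\<rho> y) (g * q)\<close>
    leads to the power \<open>g * q * a + 1\<close>, and \<open>g\<close> is the exponent that
    reproduces itself.\<close>
  have gq: "g * q * a + 1 = g"
  proof -
    have "g * q * a = q / (p - 1 - q)"
      using assms by (simp add: g_def a_def)
    then show ?thesis
      using assms by (simp add: g_def field_simps)
  qed
  have "q * a + 1 \<le> g"
  proof -
    have "1 * (q * a) \<le> g * (q * a)"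
      using \<open>1 \<le> g\<close> \<open>0 < q\<close> \<open>0 < a\<close> by (intro mult_right_mono) auto
    then show ?thesis
      using gq by (simp add: mult.assoc)
  qed
  have "0 < g * q"
    using \<open>1 \<le> g\<close> \<open>0 < q\<close> by simp
  \<comment> \<open>\<open>ennreal\<close> sends a negative \<open>C\<close> to zero, so
    \<open>C\<close> may be replaced by its nonnegative part.\<close>
  define C' where "C' = max 0 C"
  have "0 \<le> C'" and C': "ennreal C = ennreal C'"
    by (auto simp: C'_def max_def ennreal_neg)
  have W: "wolff \<alpha> p \<mu> x = wolff_tail a b 0 \<mu> x" for \<mu> :: "'a measure" and x
    unfolding a_def b_def using \<open>1 < p\<close> by (rule wolff_eq_wolff_tail)
  \<comment> \<open>The supersolution raised to \<open>q\<close> is controlled by the powers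
    \<open>q\<close> and \<open>g * q\<close> of the potential, hence two energy constants. All
    constants are fixed before \<sigma>.\<close>
  obtain e1 where e1: "wolff_energy_bound TYPE('a) \<alpha> p C' q e1"
    using wolff_energy_bound_exists[OF assms(1,4,5) \<open>0 \<le> C'\<close> \<open>0 < q\<close>] by blast
  obtain e2 where e2: "wolff_energy_bound TYPE('a) \<alpha> p C' (g * q) e2"
    using wolff_energy_bound_exists[OF assms(1,4,5) \<open>0 \<le> C'\<close> \<open>0 < g * q\<close>] by blast
  have "0 \<le> e1" "0 \<le> e2"
    using e1 e2 by (auto simp: wolff_energy_bound_def)
  define U where "U s e = 2 powr (s * a + a) * (e powr a * 2 powr b + 2 powr (b * s * a))" for s e
  have U_nonneg: "0 \<le> U s e" for s e
    by (simp add: U_def)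
  \<comment> \<open>\<open>L\<close> is the constant of the lower bound for
    \<open>s = g * q\<close>, and \<open>c0\<close> solves \<open>c0 powr (q * a) * L = c0\<close>,
    which is possible since \<open>q * a < 1\<close>; this makes \<open>c0\<close> times the power
    \<open>g\<close> of the potential a subsolution.\<close>
  define L where "L = (2::real) powr (- b * (g * q) * a - g * q * a - 1)"
  define c0 where "c0 = L powr (1 / (1 - q * a))"
  have "0 < c0" by (simp add: c0_def L_def)
  have c0: "c0 powr (q * a) * L = c0"
  proof -
    have "1 / (1 - q * a) * (q * a) + 1 = 1 / (1 - q * a)"
      using \<open>q * a < 1\<close> by (simp add: field_simps)
    then have "L powr (1 / (1 - q * a) * (q * a) + 1) = L powr (1 / (1 - q * a))"
      by (rule arg_cong)
    then show ?thesis
      unfolding c0_def powr_powr powr_add by (simp add: L_def)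
  qed
  \<comment> \<open>\<open>D\<close> gathers the factors of the supersolution estimate apart from
    \<open>c1\<close>: those for splitting sums under the powers \<open>q\<close> and
    \<open>a\<close>, and the two upper bounds, the first doubled by interpolation.
    \<open>c1\<close> is so large that \<open>c1 powr (q * a) * D \<le> c1\<close>, and at least
    \<open>c0\<close>, which orders the two barriers.\<close>
  define D where "D = 2 powr (q * a + a) * (2 * U q e1 + U (g * q) e2)"
  have "0 \<le> D" using U_nonneg by (simp add: D_def)
  define c1 where "c1 = max c0 (D powr (1 / (1 - q * a)))"
  have "0 < c1" "c0 \<le> c1"
    using \<open>0 < c0\<close> by (simp_all add: c1_def)
  have c1: "c1 powr (q * a) * D \<le> c1"
  proof -
    have "D = (D powr (1 / (1 - q * a))) powr (1 - q * a)"
      using \<open>q * a < 1\<close> \<open>0 \<le> D\<close> by (simp add: powr_powr)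
    also have "\<dots> \<le> c1 powr (1 - q * a)"
      using \<open>q * a < 1\<close> by (intro powr_mono2) (auto simp: c1_def)
    finally have "c1 powr (q * a) * D \<le> c1 powr (q * a) * c1 powr (1 - q * a)"
      by (rule mult_left_mono) simp
    also have "\<dots> = c1"
      using \<open>0 < c1\<close> by (simp add: powr_add[symmetric])
    finally show ?thesis .
  qed
  \<comment> \<open>The upper bound asks for \<open>c1 \<le> c\<close> and the lower one for
    \<open>1 / c \<le> c0\<close>.\<close>
  define c where "c = max c1 (1 / c0)"
  have "0 < c" "c1 \<le> c" using \<open>0 < c1\<close> by (auto simp: c_def)
  have "1 / c \<le> c0"
  proof -
    have "1 / c0 \<le> c" by (simp add: c_def)
    then show ?thesis
      using \<open>0 < c\<close> \<open>0 < c0\<close> by (simp add: field_simps)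
  qed
  show ?thesis
  proof (intro exI[of _ c] conjI allI impI, fact \<open>0 < c\<close>)
    fix \<sigma> :: "'a measure"
    assume [simp, measurable_cong]: "sets \<sigma> = sets borel"
      and "\<forall>K. compact K \<longrightarrow> emeasure \<sigma> K < \<infinity>"
      and "\<forall>E. compact E \<longrightarrow> emeasure \<sigma> E \<le> ennreal C * cap \<alpha> p E"
      and tail: "(\<integral>\<^sup>+ t\<in>{1..}. epowr (emeasure \<sigma> (ball 0 t) / ennreal (t powr (real DIM('a) - \<alpha> * p)))
                          (1 / (p - 1)) * ennreal (1 / t) \<partial>lborel) < \<infinity>"
    then have fin: "\<And>K. compact K \<Longrightarrow> emeasure \<sigma> K < top"
      and cap: "\<And>E. compact E \<Longrightarrow> emeasure \<sigma> E \<le> ennreal C' * cap \<alpha> p E"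
      by (auto simp: C')
    define \<rho> where "\<rho> = wolff \<alpha> p \<sigma>"
    have \<rho>: "\<rho> = wolff_tail a b 0 \<sigma>"
      unfolding \<rho>_def by (intro ext W)
    have [measurable]: "\<rho> \<in> borel_measurable borel"
      unfolding \<rho> by measurable
    \<comment> \<open>The pointwise upper bound holds for the locally finite \<sigma> itself, as its
      local hypothesis involves restrictions to balls.\<close>
    have upper: "wolff_tail a b 0 (density \<sigma> (\<lambda>y. epowr (\<rho> y) s)) x \<le> ennreal (U s e) * (\<rho> x + epowr (\<rho> x) (s * a + 1))"
      if "wolff_energy_bound TYPE('a) \<alpha> p C' s e" "0 < s" "0 \<le> e" for s e x
      unfolding \<rho> U_def
      by (rule wolff_tail_power_upper)
         (use nn_integral_wolff_restrict_le[OF _ fin cap that(1,2) \<open>1 < p\<close>] that \<open>0 < a\<close> in \<open>auto simp: W\<close>)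
    define u0 where "u0 y = ennreal c0 * epowr (\<rho> y) g" for y
    define v where "v y = ennreal c1 * (\<rho> y + epowr (\<rho> y) g)" for y
    have [measurable]: "u0 \<in> borel_measurable borel" "v \<in> borel_measurable borel"
      unfolding u0_def[abs_def] v_def[abs_def] by measurable
    have sub: "u0 x \<le> wolff \<alpha> p (density \<sigma> (\<lambda>y. epowr (u0 y) q)) x" for x
    proof -
      have eq: "epowr (u0 y) q = ennreal (c0 powr q) * epowr (\<rho> y) (g * q)" for y
        unfolding u0_def using \<open>0 < q\<close> \<open>0 < c0\<close> by (simp add: epowr_mult epowr_ennreal epowr_epowr)
      have "ennreal L * epowr (\<rho> x) (g * q * a + 1) \<le> wolff_tail a b 0 (density \<sigma> (\<lambda>y. epowr (\<rho> y) (g * q))) x"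
        unfolding L_def \<rho> using \<open>0 < a\<close> \<open>0 < g * q\<close> by (intro wolff_tail_power_lower) auto
      then have "ennreal (c0 powr (q * a)) * (ennreal L * epowr (\<rho> x) g)
        \<le> ennreal (c0 powr (q * a)) * wolff_tail a b 0 (density \<sigma> (\<lambda>y. epowr (\<rho> y) (g * q))) x"
        unfolding gq by (rule mult_left_mono) simp
      also have "\<dots> = wolff_tail a b 0 (density \<sigma> (\<lambda>y. epowr (u0 y) q)) x"
        unfolding eq using \<open>0 < a\<close> by (subst wolff_tail_density_cmult) (auto simp: epowr_ennreal powr_powr)
      also have "ennreal (c0 powr (q * a)) * (ennreal L * epowr (\<rho> x) g) = u0 x"
        unfolding u0_def mult.assoc[symmetric] using c0 by (simp add: ennreal_mult[symmetric] L_def)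
      finally show ?thesis
        by (simp add: W)
    qed
    have super: "wolff \<alpha> p (density \<sigma> (\<lambda>y. epowr (v y) q)) x \<le> v x" for x
    proof -
      let ?f1 = "\<lambda>y. epowr (\<rho> y) q" and ?f2 = "\<lambda>y. epowr (\<rho> y) (g * q)"
      let ?k = "ennreal ((2 * c1) powr q)"
      have v_pow: "epowr (v y) q \<le> ?k * (?f1 y + ?f2 y)" for y
      proof -
        have "epowr (v y) q = ennreal (c1 powr q) * epowr (\<rho> y + epowr (\<rho> y) g) q"
          unfolding v_def using \<open>0 < q\<close> \<open>0 < c1\<close> by (simp add: epowr_mult epowr_ennreal)
        also have "\<dots> \<le> ennreal (c1 powr q) * (ennreal (2 powr q) * (?f1 y + epowr (epowr (\<rho> y) g) q))"
          using \<open>0 < q\<close> by (intro mult_left_mono epowr_plus_le) auto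
        also have "\<dots> = ?k * (?f1 y + ?f2 y)"
          using \<open>0 < c1\<close> by (simp add: epowr_epowr powr_mult ennreal_mult mult_ac)
        finally show ?thesis .
      qed
      have "wolff_tail a b 0 (density \<sigma> (\<lambda>y. epowr (v y) q)) x \<le> wolff_tail a b 0 (density \<sigma> (\<lambda>y. ?k * (?f1 y + ?f2 y))) x"
        using \<open>0 < a\<close> v_pow by (intro wolff_tail_mono) (auto simp: emeasure_density intro!: nn_integral_mono mult_right_mono)
      also have "\<dots> = ennreal ((2 * c1) powr (q * a)) * wolff_tail a b 0 (density \<sigma> (\<lambda>y. ?f1 y + ?f2 y)) x"
        using \<open>0 < a\<close> by (subst wolff_tail_density_cmult) (auto simp: epowr_ennreal powr_powr)
      also have "wolff_tail a b 0 (density \<sigma> (\<lambda>y. ?f1 y + ?f2 y)) x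
        \<le> ennreal (2 powr a) * (wolff_tail a b 0 (density \<sigma> ?f1) x + wolff_tail a b 0 (density \<sigma> ?f2) x)"
        using \<open>0 < a\<close> by (intro wolff_tail_density_add_le) auto
      also have "wolff_tail a b 0 (density \<sigma> ?f1) x \<le> ennreal (U q e1) * (\<rho> x + epowr (\<rho> x) (q * a + 1))"
        using e1 \<open>0 < q\<close> \<open>0 \<le> e1\<close> by (rule upper)
      \<comment> \<open>The exponent \<open>q * a + 1\<close> lies between one and \<open>g\<close>,
        so this power is absorbed by the two that occur in \<open>v\<close>.\<close>
      also have "epowr (\<rho> x) (q * a + 1) \<le> \<rho> x + epowr (\<rho> x) g"
        using \<open>0 < q\<close> \<open>0 < a\<close> \<open>q * a + 1 \<le> g\<close> by (intro epowr_interpolate) auto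
      also have "\<rho> x + (\<rho> x + epowr (\<rho> x) g) \<le> 2 * (\<rho> x + epowr (\<rho> x) g)"
        by (simp add: mult_2 add_right_mono)
      also have "wolff_tail a b 0 (density \<sigma> ?f2) x \<le> ennreal (U (g * q) e2) * (\<rho> x + epowr (\<rho> x) g)"
        using upper[OF e2 \<open>0 < g * q\<close> \<open>0 \<le> e2\<close>, of x] unfolding gq .
      finally have "wolff_tail a b 0 (density \<sigma> (\<lambda>y. epowr (v y) q)) x
        \<le> ennreal ((2 * c1) powr (q * a)) * (ennreal (2 powr a) * (ennreal (U q e1) * (2 * (\<rho> x + epowr (\<rho> x) g))
             + ennreal (U (g * q) e2) * (\<rho> x + epowr (\<rho> x) g)))"
        by (simp add: mult_left_mono add_left_mono add_right_mono)
      also have "\<dots> = ennreal (c1 powr (q * a) * D) * (\<rho> x + epowr (\<rho> x) g)"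
      proof -
        have *: "ennreal X * (ennreal Y * (ennreal u * (2 * z) + ennreal w * z)) = ennreal (X * Y * (2 * u + w)) * z"
          if "0 \<le> X" "0 \<le> Y" "0 \<le> u" "0 \<le> w" for X Y u w z
        proof -
          have "ennreal (X * Y * (2 * u + w)) = ennreal X * ennreal Y * (2 * ennreal u + ennreal w)"
            using that by (simp add: ennreal_mult)
          then show ?thesis
            by (simp add: distrib_left distrib_right mult_ac)
        qed
        have **: "(2 * c1) powr (q * a) * 2 powr a * (2 * U q e1 + U (g * q) e2) = c1 powr (q * a) * D"
          using \<open>0 < c1\<close> by (simp add: D_def powr_mult powr_add)
        show ?thesis
          by (simp only: * ** powr_ge_zero U_nonneg)
      qed
      also have "\<dots> \<le> v x"
        unfolding v_def using c1 by (intro mult_right_mono ennreal_leI) auto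
      finally show ?thesis
        by (simp add: W)
    qed
    have "u0 x \<le> v x" for x
      unfolding u0_def v_def using \<open>c0 \<le> c1\<close> by (intro mult_mono ennreal_leI) (auto simp: add_increasing)
    from wolff_fixed_point[OF _ \<open>1 < p\<close> \<open>0 < q\<close> _ _ sub super this] obtain u where
      u [measurable]: "u \<in> borel_measurable borel"
      and fixpoint: "\<And>x. u x = wolff \<alpha> p (density \<sigma> (\<lambda>y. epowr (u y) q)) x"
      and lower: "\<And>x. u0 x \<le> u x" and upper_v: "\<And>x. u x \<le> v x"
      using \<open>sets \<sigma> = sets borel\<close> \<open>u0 \<in> borel_measurable borel\<close> \<open>v \<in> borel_measurable borel\<close> by blast
    \<comment> \<open>The bound by \<open>v\<close> reduces every exponent, \<open>q\<close>
      included, to local integrability of the powers \<open>s\<close> and \<open>g * s\<close> of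
      \<rho>.\<close>
    have Lloc: "Lloc s \<sigma> u" if "0 < s" for s
      unfolding Lloc_def
    proof (intro conjI allI impI)
      show "u \<in> borel_measurable \<sigma>" by measurable
      fix K :: "'a set" assume "compact K"
      then have [measurable]: "K \<in> sets borel" by (rule borel_compact)
      have power_fin: "(\<integral>\<^sup>+ x\<in>K. epowr (\<rho> x) t \<partial>\<sigma>) < top" if "0 < t" for t
        unfolding \<rho>_def using fin cap assms \<open>0 \<le> C'\<close> that tail \<open>compact K\<close>
        by (intro nn_integral_wolff_power_finite[where C = C']) auto
      let ?k = "ennreal (c1 powr s) * ennreal (2 powr s)"
      have "(\<integral>\<^sup>+ x\<in>K. epowr (u x) s \<partial>\<sigma>) \<le> (\<integral>\<^sup>+ x. ?k * (epowr (\<rho> x) s * indicator K x + epowr (\<rho> x) (g * s) * indicator K x) \<partial>\<sigma>)"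
      proof (rule nn_integral_mono)
        fix x
        have "epowr (u x) s \<le> epowr (v x) s"
          using upper_v that by (intro epowr_mono) auto
        also have "\<dots> = ennreal (c1 powr s) * epowr (\<rho> x + epowr (\<rho> x) g) s"
          unfolding v_def using \<open>0 < s\<close> \<open>0 < c1\<close> by (simp add: epowr_mult epowr_ennreal)
        also have "\<dots> \<le> ennreal (c1 powr s) * (ennreal (2 powr s) * (epowr (\<rho> x) s + epowr (epowr (\<rho> x) g) s))"
          using \<open>0 < s\<close> by (intro mult_left_mono epowr_plus_le) auto
        finally show "epowr (u x) s * indicator K x \<le> ?k * (epowr (\<rho> x) s * indicator K x + epowr (\<rho> x) (g * s) * indicator K x)"
          by (auto split: split_indicator simp: epowr_epowr mult.assoc)
      qed
      also have "\<dots> = ?k * ((\<integral>\<^sup>+ x\<in>K. epowr (\<rho> x) s \<partial>\<sigma>) + (\<integral>\<^sup>+ x\<in>K. epowr (\<rho> x) (g * s) \<partial>\<sigma>))"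
        by (simp add: nn_integral_cmult nn_integral_add)
      also have "\<dots> < \<infinity>"
        using power_fin[OF \<open>0 < s\<close>] power_fin[of "g * s"] \<open>1 \<le> g\<close> \<open>0 < s\<close> by (simp add: ennreal_mult_less_top)
      finally show "(\<integral>\<^sup>+ x\<in>K. epowr (u x) s \<partial>\<sigma>) < \<infinity>" .
    qed
    have "ennreal (1 / c) * epowr (\<rho> x) g \<le> u x" for x
    proof -
      have "ennreal (1 / c) * epowr (\<rho> x) g \<le> u0 x"
        unfolding u0_def using \<open>1 / c \<le> c0\<close> by (intro mult_right_mono ennreal_leI) auto
      also have "\<dots> \<le> u x" by (rule lower)
      finally show ?thesis .
    qed
    moreover have "u x \<le> ennreal c * (\<rho> x + epowr (\<rho> x) g)" for x
      using upper_v[of x] unfolding v_def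
      by (rule order_trans) (intro mult_right_mono ennreal_leI \<open>c1 \<le> c\<close>, simp)
    ultimately show "\<exists>u :: 'a \<Rightarrow> ennreal.
        Lloc q \<sigma> u \<and>
        (\<forall>x. u x = wolff \<alpha> p (density \<sigma> (\<lambda>y. epowr (u y) q)) x) \<and>
        (\<forall>x. ennreal (1 / c) * epowr (wolff \<alpha> p \<sigma> x) ((p - 1) / (p - 1 - q)) \<le> u x) \<and>
        (\<forall>x. u x \<le> ennreal c * (wolff \<alpha> p \<sigma> x + epowr (wolff \<alpha> p \<sigma> x) ((p - 1) / (p - 1 - q)))) \<and>
        (\<forall>s>0. Lloc s \<sigma> u)"
      using Lloc fixpoint \<open>0 < q\<close> unfolding \<rho>_def g_def by blast
  qed
qed

end
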